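(* Let $\mathbf{x}:(U,0)\to(\mathbb{R}^3,0)$ be a germ of a proper wavefront which is parallelly smoothable at $0\in\Sigma(\mathbf{x})$, with $\mathrm{rank}(D\mathbf{x}(0))=1$. Then, up to an isometry of $\mathbb{R}^3$, $\mathbf{x}$ is $\mathscr{R}$-equivalent to $$\mathbf{y}(w,z)=\Big(w,\ \int_0^z\lambda(w,t)\,dt+f_1(w),\ \int_0^z t\,\lambda(w,t)\,dt+f_2(w)\Big),$$ where $f_1(w),f_2(w)$ are smooth functions and $\lambda(w,z)$ is a smooth function with $\lambda(0)=0$ that does not change sign on a neighborhood of $0$.
   Context: All maps are $C^\infty$ and $U\subset\mathbb{R}^2$ is open. $D$ denotes the Jacobian matrix. A map $\mathbf{x}:U\to\mathbb{R}^3$ is a frontal if near each point $p$ there is a smooth unit vector field $\mathbf{n}_p$ orthogonal to $\mathbf{x}_u,\mathbf{x}_v$, and a wavefront if moreover each $(\mathbf{x},\mathbf{n}_p)$ is an immersion into $\mathbb{R}^3\times S^2$; a smooth unit normal field $\mathbf{n}$ on $U$ is assumed to be fixed. $\Sigma(\mathbf{x})$ is the set of points where $\mathbf{x}$ is not immersive; $\mathbf{x}$ is proper if $\Sigma(\mathbf{x})$ has empty interior. A wavefront $\mathbf{x}$ is parallelly smoothable at $p\in\Sigma(\mathbf{x})$ if there exist $\epsilon>0$ and an open neighborhood $V$ of $p$ such that $\mathrm{rank}(D(\mathbf{x}+l\mathbf{n})(q))=2$ for every $(q,l)\in V\times(0,\epsilon)$ or for every $(q,l)\in V\times(-\epsilon,0)$.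 Two map germs $\mathbf{f}_1:(U_1,p)\to(\mathbb{R}^n,q)$, $\mathbf{f}_2:(U_2,p)\to(\mathbb{R}^n,q)$ are $\mathscr{R}$-equivalent if $\mathbf{f}_2=\mathbf{f}_1\circ\mathbf{h}$ for a diffeomorphism germ $\mathbf{h}:(U_2,p)\to(U_1,p)$. "Up to an isometry" means after composing $\mathbf{x}$ on the left with an isometry of $\mathbb{R}^3$. "Does not change sign" means $\geq0$ everywhere or $\leq0$ everywhere. *)

theory Defs
  imports "HOL-Analysis.Analysis"
begin

(* The following notions are only meaningful for open sets S, V, W, U: derivatives are taken
   at interior points. Maps defined on an open set are total functions whose values outside
   that set are irrelevant. *)

primrec Ck_on :: "nat \<Rightarrow> 'a::real_normed_vector set \<Rightarrow> ('a \<Rightarrow> 'b::real_normed_vector) \<Rightarrow> bool" where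
  "Ck_on 0 S f \<longleftrightarrow> continuous_on S f"
| "Ck_on (Suc k) S f \<longleftrightarrow>
     (\<forall>p\<in>S. f differentiable (at p)) \<and>
     (\<forall>v. Ck_on k S (\<lambda>p. frechet_derivative f (at p) v))"

definition smooth_on :: "'a::real_normed_vector set \<Rightarrow> ('a \<Rightarrow> 'b::real_normed_vector) \<Rightarrow> bool" where
  "smooth_on S f \<longleftrightarrow> (\<forall>k. Ck_on k S f)"

definition diffeomorphism_on ::
    "'a::real_normed_vector set \<Rightarrow> 'b::real_normed_vector set \<Rightarrow> ('a \<Rightarrow> 'b) \<Rightarrow> bool" where
  "diffeomorphism_on V W h \<longleftrightarrow> (\<exists>g. homeomorphism V W h g \<and> smooth_on V h \<and> smooth_on W g)"

(* f1 and f2 represent germs at p, with domains U1 and U2. *)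
definition R_equivalent ::
    "'a::real_normed_vector set \<Rightarrow> ('a \<Rightarrow> 'b) \<Rightarrow> 'a set \<Rightarrow> ('a \<Rightarrow> 'b) \<Rightarrow> 'a \<Rightarrow> bool" where
  "R_equivalent U1 f1 U2 f2 p \<longleftrightarrow>
     (\<exists>V1 V2 h. open V1 \<and> p \<in> V1 \<and> V1 \<subseteq> U1 \<and> open V2 \<and> p \<in> V2 \<and> V2 \<subseteq> U2 \<and>
        diffeomorphism_on V2 V1 h \<and> h p = p \<and> (\<forall>q\<in>V2. f2 q = f1 (h q)))"

definition immersive_at :: "('a::real_normed_vector \<Rightarrow> 'b::real_normed_vector) \<Rightarrow> 'a \<Rightarrow> bool" where
  "immersive_at f p \<longleftrightarrow> f differentiable (at p) \<and> inj (frechet_derivative f (at p))"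

definition unit_normal_on :: "(real^2) set \<Rightarrow> (real^2 \<Rightarrow> real^3) \<Rightarrow> (real^2 \<Rightarrow> real^3) \<Rightarrow> bool" where
  "unit_normal_on V x n \<longleftrightarrow>
     smooth_on V n \<and>
     (\<forall>q\<in>V. norm (n q) = 1 \<and> (\<forall>i. n q \<bullet> frechet_derivative x (at q) (axis i 1) = 0))"

(* Without the last conjunct this says that x is a frontal. A map into R^3 x S^2
   is immersive iff it is immersive as a map into R^3 x R^3. *)
definition wavefront_on :: "(real^2) set \<Rightarrow> (real^2 \<Rightarrow> real^3) \<Rightarrow> bool" where
  "wavefront_on U x \<longleftrightarrow>
     smooth_on U x \<and>
     (\<forall>p\<in>U. \<exists>V n. open V \<and> p \<in> V \<and> V \<subseteq> U \<and> unit_normal_on V x n \<and>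
        (\<forall>q\<in>V. immersive_at (\<lambda>r. (x r, n r)) q))"

definition singular_set :: "(real^2) set \<Rightarrow> (real^2 \<Rightarrow> real^3) \<Rightarrow> (real^2) set" where
  "singular_set U x = {p\<in>U. \<not> immersive_at x p}"

definition proper_on :: "(real^2) set \<Rightarrow> (real^2 \<Rightarrow> real^3) \<Rightarrow> bool" where
  "proper_on U x \<longleftrightarrow> interior (singular_set U x) = {}"

definition parallelly_smoothable_at ::
    "(real^2) set \<Rightarrow> (real^2 \<Rightarrow> real^3) \<Rightarrow> (real^2 \<Rightarrow> real^3) \<Rightarrow> real^2 \<Rightarrow> bool" where
  "parallelly_smoothable_at U x n p \<longleftrightarrow>
     p \<in> singular_set U x \<and>
     (\<exists>\<epsilon>>0. \<exists>V. open V \<and> p \<in> V \<and> V \<subseteq> U \<and>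
        ((\<forall>q\<in>V. \<forall>l\<in>{0<..<\<epsilon>}. rank (jacobian (\<lambda>r. x r + l *\<^sub>R n r) (at q)) = 2) \<or>
         (\<forall>q\<in>V. \<forall>l\<in>{-\<epsilon><..<0}. rank (jacobian (\<lambda>r. x r + l *\<^sub>R n r) (at q)) = 2)))"

definition no_sign_change_on :: "'a set \<Rightarrow> ('a \<Rightarrow> real) \<Rightarrow> bool" where
  "no_sign_change_on N f \<longleftrightarrow> (\<forall>p\<in>N. 0 \<le> f p) \<or> (\<forall>p\<in>N. f p \<le> 0)"

definition open_square :: "real \<Rightarrow> (real^2) set" where
  "open_square \<delta> = {p. \<forall>i. \<bar>p $ i\<bar> < \<delta>}"

(* The interval integrals are signed, so z may be negative. *)
definition normal_form ::
    "(real^2 \<Rightarrow> real) \<Rightarrow> (real \<Rightarrow> real) \<Rightarrow> (real \<Rightarrow> real) \<Rightarrow> real^2 \<Rightarrow> real^3" where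
  "normal_form lam f1 f2 p =
     (let w = p $ 1; z = p $ 2 in
      vector [w,
              (LBINT t=0..z. lam (vector [w, t])) + f1 w,
              (LBINT t=0..z. t * lam (vector [w, t])) + f2 w])"

end

theory Submission
  imports Defs
begin

text \<open>Rotate space so that at \<open>0\<close> the image of \<open>Dx\<close> is the first axis and the normal is the
  third.  A surface in the wanted form \<open>y(w, z)\<close> has \<open>y\<^sub>z = \<lambda> (0, 1, z)\<close>, so its normal satisfies
  \<open>n\<^sub>2 = - z n\<^sub>3\<close>; this dictates the change of parameters: \<open>w = x\<^sub>1\<close> and \<open>z = - n\<^sub>2 / n\<^sub>3\<close>.

  These functions are coordinates near \<open>0\<close> because \<open>x\<close> is a wavefront.  If \<open>k\<close> spans
  the kernel of \<open>Dx\<close> at \<open>0\<close>, then \<open>Dn k\<close> is nonzero; it is orthogonal to \<open>n\<close> because \<open>n\<close> has unit length,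
  and to the image of \<open>Dx\<close> because the second fundamental form is symmetric, so it has a nonzero
  second component (\<open>slope_coordinates\<close>).  That the prescribed \<open>n\<close>, and not only the local normals
  in the definition of a wavefront, makes \<open>(x, n)\<close> immersive follows from properness: on the dense set of
  immersive points two unit normals agree up to sign (\<open>wavefront_immersive_with_normal\<close>).

  Conversely, once these are the coordinates, \<open>n \<bullet> y\<^sub>z = 0\<close> reads \<open>dy\<^sub>3/dz = z dy\<^sub>2/dz\<close>, and
  integration in \<open>z\<close> gives the formula with \<open>\<lambda> = dy\<^sub>2/dz\<close> (\<open>eq_normal_form\<close>); \<open>\<lambda>(0) = 0\<close>
  since the image of \<open>Dy\<close> at \<open>0\<close> is the first axis.

  For the sign, the area density of \<open>x + l n\<close>, taken with respect to \<open>n\<close>, is continuous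
  and has no zero for \<open>q\<close> near \<open>0\<close> and small \<open>l\<close> of one sign, hence is of constant sign there.
  In the limit \<open>l = 0\<close> it becomes \<open>\<lambda>\<close> times a positive function
  (\<open>no_sign_change_if_parallels_immersive\<close>).\<close>

section \<open>Calculus of \<open>C\<^sup>k\<close> maps\<close>

lemma Ck_on_cong:
  assumes "open S" and "\<And>p. p \<in> S \<Longrightarrow> f p = g p"
  shows "Ck_on k S f \<longleftrightarrow> Ck_on k S g"
  using assms(2)
proof (induction k arbitrary: f g)
  case 0
  then show ?case by (auto cong: continuous_on_cong)
next
  case (Suc k)
  have diff: "f differentiable (at p) \<longleftrightarrow> g differentiable (at p)" if "p \<in> S" for p
    using \<open>open S\<close> Suc.prems that unfolding differentiable_def
    by (metis has_derivative_transform_within_open)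
  have fd: "frechet_derivative f (at p) = frechet_derivative g (at p)"
    if "p \<in> S" "f differentiable (at p)" for p
    using that \<open>open S\<close> Suc.prems by (intro frechet_derivative_transform_within_open) auto
  show ?case
    using diff fd Suc.IH[of "\<lambda>p. frechet_derivative f (at p) v" "\<lambda>p. frechet_derivative g (at p) v" for v]
    by (auto; metis)
qed

lemma Ck_on_subset: "Ck_on k S f \<Longrightarrow> T \<subseteq> S \<Longrightarrow> Ck_on k T f"
  by (induction k arbitrary: f) (auto intro: continuous_on_subset)

lemma Ck_on_SucI:
  assumes "open S" and "\<And>p. p \<in> S \<Longrightarrow> (f has_derivative f' p) (at p)"
    and "\<And>v. Ck_on k S (\<lambda>p. f' p v)"
  shows "Ck_on (Suc k) S f"
proof -
  have "Ck_on k S (\<lambda>p. frechet_derivative f (at p) v)" for v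
    using assms frechet_derivative_at[OF assms(2)]
    by (subst Ck_on_cong[where g = "\<lambda>p. f' p v"]) auto
  then show ?thesis using assms(2) by (auto simp: differentiable_def)
qed

lemma Ck_on_has_derivative:
  "Ck_on (Suc k) S f \<Longrightarrow> p \<in> S \<Longrightarrow> (f has_derivative frechet_derivative f (at p)) (at p)"
  by (simp flip: frechet_derivative_works)

lemma Ck_on_Suc_imp: "Ck_on (Suc k) S f \<Longrightarrow> Ck_on k S f"
proof (induction k arbitrary: f)
  case 0
  then show ?case
    by (auto intro!: continuous_at_imp_continuous_on differentiable_imp_continuous_within)
next
  case (Suc k)
  then show ?case by (metis Ck_on.simps(2))
qed

lemma Ck_on_const: "Ck_on k S (\<lambda>p. c)"
  by (induction k arbitrary: c) (auto)

lemma Ck_on_bounded_linear: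
  assumes "bounded_linear L" "open S"
  shows "Ck_on k S L"
proof (cases k)
  case 0
  then show ?thesis by (simp add: assms(1) linear_continuous_on)
next
  case (Suc m)
  have "(L has_derivative L) (at p)" for p by (simp add: assms bounded_linear_imp_has_derivative)
  then show ?thesis unfolding Suc by (intro Ck_on_SucI[where f' = "\<lambda>p. L"]) (auto simp: Ck_on_const assms)
qed

lemma Ck_on_add:
  assumes "open S" "Ck_on k S f" "Ck_on k S g"
  shows "Ck_on k S (\<lambda>p. f p + g p)"
  using assms(2,3)
proof (induction k arbitrary: f g)
  case 0
  then show ?case by (auto intro: continuous_on_add)
next
  case (Suc k)
  have "((\<lambda>p. f p + g p) has_derivative
     (\<lambda>v. frechet_derivative f (at p) v + frechet_derivative g (at p) v)) (at p)" if "p \<in> S" for p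
    using Suc.prems that by (intro has_derivative_add Ck_on_has_derivative)
  then show ?case
    by (rule Ck_on_SucI[OF \<open>open S\<close>]) (use Suc in auto)
qed

lemma Ck_on_sum:
  assumes "open S" "finite I" "\<And>i. i \<in> I \<Longrightarrow> Ck_on k S (f i)"
  shows "Ck_on k S (\<lambda>p. \<Sum>i\<in>I. f i p)"
  using assms(2,3) by (induction I) (auto simp: Ck_on_const intro!: Ck_on_add[OF assms(1)])

lemma Ck_on_bilinear:
  assumes "bounded_bilinear B" "open S" "Ck_on k S f" "Ck_on k S g"
  shows "Ck_on k S (\<lambda>p. B (f p) (g p))"
  using assms(3,4)
proof (induction k arbitrary: f g)
  case 0
  then show ?case using assms(1) by (auto intro: bounded_bilinear.continuous_on)
next
  case (Suc k)
  have "((\<lambda>p. B (f p) (g p)) has_derivative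
     (\<lambda>v. B (f p) (frechet_derivative g (at p) v) + B (frechet_derivative f (at p) v) (g p))) (at p)"
    if "p \<in> S" for p
    using Suc.prems that by (intro bounded_bilinear.FDERIV[OF assms(1)] Ck_on_has_derivative)
  then show ?case
    by (rule Ck_on_SucI[OF \<open>open S\<close>])
       (use Suc.prems Suc.prems[THEN Ck_on_Suc_imp] in \<open>auto intro!: Ck_on_add[OF \<open>open S\<close>] Suc.IH\<close>)
qed

lemmas Ck_on_mult = Ck_on_bilinear[OF bounded_bilinear_mult]
lemmas Ck_on_scaleR = Ck_on_bilinear[OF bounded_bilinear_scaleR]

text \<open>In the chain rule the direction in which the outer map is differentiated depends on the
  point.  Expanding it in a basis turns the derivative of a composition into a finite sum of products
  of functions of the form that the induction hypothesis speaks of; this is why the intermediate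
  space is Euclidean.\<close>
lemma Ck_on_compose:
  fixes g :: "'a::real_normed_vector \<Rightarrow> 'b::euclidean_space" and f :: "'b \<Rightarrow> 'c::real_normed_vector"
  assumes "open S" "Ck_on k T f" "Ck_on k S g" "g ` S \<subseteq> T"
  shows "Ck_on k S (\<lambda>p. f (g p))"
  using assms(2,3,4)
proof (induction k arbitrary: f)
  case 0
  then show ?case by (auto intro: continuous_on_compose2)
next
  case (Suc k)
  let ?f' = "\<lambda>p. frechet_derivative f (at p)" and ?g' = "\<lambda>p. frechet_derivative g (at p)"
  have D: "((\<lambda>p. f (g p)) has_derivative (\<lambda>v. \<Sum>b\<in>Basis. (?g' p v \<bullet> b) *\<^sub>R ?f' (g p) b)) (at p)"
    if "p \<in> S" for p
  proof -
    have f': "(f has_derivative ?f' (g p)) (at (g p))"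
      using Suc.prems that by (intro Ck_on_has_derivative) auto
    have "((\<lambda>p. f (g p)) has_derivative (\<lambda>v. ?f' (g p) (?g' p v))) (at p)"
      using Suc.prems that by (intro has_derivative_compose[of g "?g' p" p UNIV f "?f' (g p)"] f' Ck_on_has_derivative)
    moreover have "?f' (g p) (?g' p v) = (\<Sum>b\<in>Basis. (?g' p v \<bullet> b) *\<^sub>R ?f' (g p) b)" for v
      using has_derivative_linear[OF f'] linear_sum[OF has_derivative_linear[OF f'], of "\<lambda>b. (?g' p v \<bullet> b) *\<^sub>R b" Basis]
      by (simp add: euclidean_representation linear_scale)
    ultimately show ?thesis by (simp only:)
  qed
  let ?F = "\<lambda>p v. \<Sum>b\<in>Basis. (?g' p v \<bullet> b) *\<^sub>R ?f' (g p) b"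
  have f'g: "Ck_on k S (\<lambda>p. ?f' (g p) b)" for b
    using Suc.prems Ck_on_Suc_imp[OF Suc.prems(2)] by (intro Suc.IH[of "\<lambda>q. ?f' q b"]) auto
  have "Ck_on k S (\<lambda>p. ?g' p v \<bullet> b)" for v b
    using Suc.prems
    by (intro Ck_on_bilinear[OF bounded_bilinear_inner, of S k "\<lambda>p. ?g' p v"] \<open>open S\<close> Ck_on_const) auto
  then have "Ck_on k S (\<lambda>p. \<Sum>b\<in>Basis. (?g' p v \<bullet> b) *\<^sub>R ?f' (g p) b)" for v
    by (intro Ck_on_sum \<open>open S\<close> Ck_on_scaleR f'g) auto
  then show ?case
    using D by (intro Ck_on_SucI[OF \<open>open S\<close>, where f' = ?F]) auto
qed

lemma Ck_on_inverse:
  fixes f :: "'a::real_normed_vector \<Rightarrow> real"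
  assumes "open S" "Ck_on k S f" "\<And>p. p \<in> S \<Longrightarrow> f p \<noteq> 0"
  shows "Ck_on k S (\<lambda>p. inverse (f p))"
  using assms(2)
proof (induction k)
  case 0
  then show ?case using assms(3) by (auto intro!: continuous_on_inverse)
next
  case (Suc k)
  let ?f' = "\<lambda>p. frechet_derivative f (at p)"
  have D: "((\<lambda>p. inverse (f p)) has_derivative
      (\<lambda>v. (-1) * ((inverse (f p) * ?f' p v) * inverse (f p)))) (at p)" if "p \<in> S" for p
    using Deriv.has_derivative_inverse[OF assms(3)[OF that] Ck_on_has_derivative[OF Suc.prems that]]
    by simp
  let ?F = "\<lambda>p v. (-1) * ((inverse (f p) * ?f' p v) * inverse (f p))"
  have IH: "Ck_on k S (\<lambda>p. inverse (f p))" by (rule Suc.IH[OF Ck_on_Suc_imp[OF Suc.prems]])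
  have "Ck_on k S (\<lambda>p. ?f' p v)" for v using Suc.prems by auto
  then have "Ck_on k S (\<lambda>p. (-1) * ((inverse (f p) * ?f' p v) * inverse (f p)))" for v
    by (intro Ck_on_mult \<open>open S\<close> IH Ck_on_const)
  then show ?case
    using D by (intro Ck_on_SucI[OF \<open>open S\<close>, where f' = ?F]) auto
qed

lemma smooth_on_subset: "smooth_on S f \<Longrightarrow> T \<subseteq> S \<Longrightarrow> smooth_on T f"
  unfolding smooth_on_def by (metis Ck_on_subset)

lemma smooth_on_const: "smooth_on S (\<lambda>p. c)"
  unfolding smooth_on_def by (metis Ck_on_const)

lemma smooth_on_bounded_linear: "bounded_linear L \<Longrightarrow> open S \<Longrightarrow> smooth_on S L"
  unfolding smooth_on_def by (metis Ck_on_bounded_linear)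

lemma smooth_on_add:
  "open S \<Longrightarrow> smooth_on S f \<Longrightarrow> smooth_on S g \<Longrightarrow> smooth_on S (\<lambda>p. f p + g p)"
  unfolding smooth_on_def by (metis Ck_on_add)

lemma smooth_on_bilinear:
  "bounded_bilinear B \<Longrightarrow> open S \<Longrightarrow> smooth_on S f \<Longrightarrow> smooth_on S g \<Longrightarrow>
    smooth_on S (\<lambda>p. B (f p) (g p))"
  unfolding smooth_on_def by (metis Ck_on_bilinear)

lemma smooth_on_compose:
  fixes g :: "'a::real_normed_vector \<Rightarrow> 'b::euclidean_space"
  shows "open S \<Longrightarrow> smooth_on T f \<Longrightarrow> smooth_on S g \<Longrightarrow> g ` S \<subseteq> T \<Longrightarrow>
    smooth_on S (\<lambda>p. f (g p))"
  unfolding smooth_on_def by (metis Ck_on_compose)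

lemma smooth_on_linear_image:
  fixes g :: "'a::real_normed_vector \<Rightarrow> 'b::euclidean_space"
  assumes "bounded_linear L" "open S" "smooth_on S g"
  shows "smooth_on S (\<lambda>p. L (g p))"
  using smooth_on_compose[OF assms(2) smooth_on_bounded_linear[OF assms(1) open_UNIV] assms(3)] by simp

lemma smooth_on_inverse:
  fixes f :: "'a::real_normed_vector \<Rightarrow> real"
  shows "open S \<Longrightarrow> smooth_on S f \<Longrightarrow> (\<And>p. p \<in> S \<Longrightarrow> f p \<noteq> 0) \<Longrightarrow> smooth_on S (\<lambda>p. inverse (f p))"
  unfolding smooth_on_def by (metis Ck_on_inverse)

lemma smooth_on_derivative:
  "smooth_on S f \<Longrightarrow> smooth_on S (\<lambda>p. frechet_derivative f (at p) v)"
  unfolding smooth_on_def by (metis Ck_on.simps(2))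

lemma smooth_on_has_derivative:
  "smooth_on S f \<Longrightarrow> p \<in> S \<Longrightarrow> (f has_derivative frechet_derivative f (at p)) (at p)"
  unfolding smooth_on_def by (metis Ck_on_has_derivative)

lemma smooth_on_imp_continuous_on: "smooth_on S f \<Longrightarrow> continuous_on S f"
  unfolding smooth_on_def by (metis Ck_on.simps(1))

section \<open>Symmetry of second derivatives\<close>

lemma smooth_on_along_curve:
  fixes c :: "real \<Rightarrow> 'a::real_normed_vector"
  assumes "smooth_on S f" "c t \<in> S" "(c has_vector_derivative u) (at t)"
  shows "((\<lambda>t. f (c t)) has_vector_derivative frechet_derivative f (at (c t)) u) (at t)"
proof -
  note f' = smooth_on_has_derivative[OF assms(1,2)]
  have "((\<lambda>t. f (c t)) has_derivative (\<lambda>r. frechet_derivative f (at (c t)) (r *\<^sub>R u))) (at t)"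
    by (rule has_derivative_compose[where f = c and g = f])
       (use assms f' in \<open>auto simp: has_vector_derivative_def\<close>)
  then show ?thesis
    unfolding has_vector_derivative_def
    using has_derivative_linear[OF f'] by (simp add: linear_scale)
qed

text \<open>Second differences \<open>f (p + h v + h w) - f (p + h v) - f (p + h w) + f p\<close> are symmetric in
  the two directions, and two applications of the mean value theorem express them, up to the factor
  \<open>h\<^sup>2\<close>, by a second derivative at a point close to \<open>p\<close>.\<close>
lemma second_difference_tendsto:
  fixes f :: "'a::real_normed_vector \<Rightarrow> real"
  assumes "open S" "smooth_on S f" "p \<in> S"
  defines "D \<equiv> (\<lambda>v q. frechet_derivative f (at q) v)"
  shows "((\<lambda>h. (f (p + h *\<^sub>R v + h *\<^sub>R w) - f (p + h *\<^sub>R v) - f (p + h *\<^sub>R w) + f p) / h\<^sup>2)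
    \<longlongrightarrow> frechet_derivative (D v) (at p) w) (at_right 0)"
proof (rule tendstoI)
  fix e :: real assume "e > 0"
  let ?E = "\<lambda>q. frechet_derivative (D v) (at q) w"
  have sD: "smooth_on S (D v)" unfolding D_def by (intro smooth_on_derivative assms)
  then have "continuous_on S ?E" by (intro smooth_on_imp_continuous_on smooth_on_derivative)
  then have "isCont ?E p" using assms by (simp add: continuous_on_eq_continuous_at)
  then obtain d1 where d1: "d1 > 0" "\<And>q. dist q p < d1 \<Longrightarrow> dist (?E q) (?E p) < e"
    using \<open>e > 0\<close> unfolding continuous_at_eps_delta by metis
  obtain d2 where d2: "d2 > 0" "ball p d2 \<subseteq> S" using assms openE by blast
  define d where "d = min d1 d2 / (norm v + norm w + 1)"
  have "d > 0" unfolding d_def using d1 d2 by (intro divide_pos_pos) (auto intro: add_nonneg_pos)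
  have near: "dist (p + s *\<^sub>R v + t *\<^sub>R w) p < min d1 d2"
    if "0 \<le> s" "s < d" "0 \<le> t" "t < d" for s t
  proof -
    have "dist (p + s *\<^sub>R v + t *\<^sub>R w) p = norm (s *\<^sub>R v + t *\<^sub>R w)" by (simp add: dist_norm add.assoc)
    also have "\<dots> \<le> s * norm v + t * norm w"
      using that by (intro order_trans[OF norm_triangle_ineq]) simp
    also have "\<dots> \<le> d * norm v + d * norm w"
      using that by (intro add_mono mult_right_mono) auto
    also have "\<dots> < d * (norm v + norm w + 1)" using \<open>d > 0\<close> by (simp add: algebra_simps)
    also have "\<dots> = min d1 d2" unfolding d_def using add_nonneg_pos[of "norm v + norm w" 1] by simp
    finally show ?thesis .
  qed
  then have inS: "p + s *\<^sub>R v + t *\<^sub>R w \<in> S" if "0 \<le> s" "s < d" "0 \<le> t" "t < d" for s t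
    using that d2(2) by (auto simp: dist_commute subset_iff)
  have quot: "dist ((f (p + h *\<^sub>R v + h *\<^sub>R w) - f (p + h *\<^sub>R v) - f (p + h *\<^sub>R w) + f p) / h\<^sup>2) (?E p) < e"
    if h: "0 < h" "h < d" for h
  proof -
    define \<phi> where "\<phi> s = f (p + s *\<^sub>R v + h *\<^sub>R w) - f (p + s *\<^sub>R v + 0 *\<^sub>R w)" for s
    have line: "((\<lambda>s. f (p + s *\<^sub>R v + t *\<^sub>R w)) has_real_derivative D v (p + s *\<^sub>R v + t *\<^sub>R w)) (at s)"
      if "0 \<le> s" "s < d" "0 \<le> t" "t < d" for s t
      unfolding has_real_derivative_iff_has_vector_derivative D_def
      by (rule smooth_on_along_curve[where c = "\<lambda>s. p + s *\<^sub>R v + t *\<^sub>R w", OF assms(2)])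
        (use that inS in \<open>auto intro!: derivative_eq_intros\<close>)
    have "(\<phi> has_real_derivative D v (p + s *\<^sub>R v + h *\<^sub>R w) - D v (p + s *\<^sub>R v + 0 *\<^sub>R w)) (at s)"
      if "0 \<le> s" "s \<le> h" for s
      unfolding \<phi>_def using that h \<open>d > 0\<close> by (intro DERIV_diff line) auto
    then obtain s where s: "0 < s" "s < h"
        "\<phi> h - \<phi> 0 = (h - 0) * (D v (p + s *\<^sub>R v + h *\<^sub>R w) - D v (p + s *\<^sub>R v + 0 *\<^sub>R w))"
      using MVT2[of 0 h \<phi> "\<lambda>s. D v (p + s *\<^sub>R v + h *\<^sub>R w) - D v (p + s *\<^sub>R v + 0 *\<^sub>R w)"]
        h by blast
    have lineD: "((\<lambda>t. D v (p + s *\<^sub>R v + t *\<^sub>R w)) has_real_derivative ?E (p + s *\<^sub>R v + t *\<^sub>R w)) (at t)"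
      if "0 \<le> t" "t < d" for t
      unfolding has_real_derivative_iff_has_vector_derivative
      by (rule smooth_on_along_curve[where c = "\<lambda>t. p + s *\<^sub>R v + t *\<^sub>R w", OF sD])
        (use that s h inS in \<open>auto intro!: derivative_eq_intros\<close>)
    have "((\<lambda>t. D v (p + s *\<^sub>R v + t *\<^sub>R w)) has_real_derivative ?E (p + s *\<^sub>R v + t *\<^sub>R w)) (at t)"
      if "0 \<le> t" "t \<le> h" for t
      using that h by (intro lineD) auto
    then obtain t where t: "0 < t" "t < h"
        "D v (p + s *\<^sub>R v + h *\<^sub>R w) - D v (p + s *\<^sub>R v + 0 *\<^sub>R w) = (h - 0) * ?E (p + s *\<^sub>R v + t *\<^sub>R w)"
      using MVT2[of 0 h "\<lambda>t. D v (p + s *\<^sub>R v + t *\<^sub>R w)" "\<lambda>t. ?E (p + s *\<^sub>R v + t *\<^sub>R w)"]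
        h by blast
    have "f (p + h *\<^sub>R v + h *\<^sub>R w) - f (p + h *\<^sub>R v) - f (p + h *\<^sub>R w) + f p = h\<^sup>2 * ?E (p + s *\<^sub>R v + t *\<^sub>R w)"
      using s(3) t(3) by (simp add: \<phi>_def power2_eq_square)
    moreover have "dist (?E (p + s *\<^sub>R v + t *\<^sub>R w)) (?E p) < e"
      using near[of s t] s t h by (intro d1(2)) auto
    ultimately show ?thesis using h by simp
  qed
  show "\<forall>\<^sub>F h in at_right 0. dist ((f (p + h *\<^sub>R v + h *\<^sub>R w) - f (p + h *\<^sub>R v) - f (p + h *\<^sub>R w) + f p) / h\<^sup>2)
      (frechet_derivative (D v) (at p) w) < e"
    unfolding eventually_at_right_field using \<open>d > 0\<close> quot by blast
qed

lemma second_derivative_symmetric: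
  fixes f :: "'a::real_normed_vector \<Rightarrow> real"
  assumes "open S" "smooth_on S f" "p \<in> S"
  shows "frechet_derivative (\<lambda>q. frechet_derivative f (at q) v) (at p) w =
    frechet_derivative (\<lambda>q. frechet_derivative f (at q) w) (at p) v"
  using tendsto_unique[OF trivial_limit_at_right_real second_difference_tendsto[OF assms, of v w]]
    second_difference_tendsto[OF assms, of w v]
  by (simp add: algebra_simps)

section \<open>Smooth inverse functions\<close>

lemma Ck_on_prod:
  fixes f :: "'i \<Rightarrow> 'a::real_normed_vector \<Rightarrow> real"
  assumes "open S" "finite I" "\<And>i. i \<in> I \<Longrightarrow> Ck_on k S (f i)"
  shows "Ck_on k S (\<lambda>p. \<Prod>i\<in>I. f i p)"
  using assms(2,3) by (induction I) (auto simp: Ck_on_const intro!: Ck_on_mult[OF assms(1)])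

lemma Ck_on_det:
  fixes A :: "'a::real_normed_vector \<Rightarrow> real^'n^'n"
  assumes "open S" "\<And>i j. Ck_on k S (\<lambda>p. A p $ i $ j)"
  shows "Ck_on k S (\<lambda>p. det (A p))"
  unfolding det_def
  by (rule Ck_on_sum; (rule Ck_on_mult)?; (rule Ck_on_prod)?)
     (auto simp: assms Ck_on_const finite_permutations)

lemma Ck_on_vec:
  fixes f :: "'n::finite \<Rightarrow> 'a::real_normed_vector \<Rightarrow> real"
  assumes "open S" "\<And>i. Ck_on k S (f i)"
  shows "Ck_on k S (\<lambda>p. \<chi> i. f i p)"
proof -
  have "(\<chi> i. f i p) = (\<Sum>i\<in>UNIV. f i p *\<^sub>R axis i 1)" for p
    by (simp add: vec_eq_iff axis_def if_distrib cong: if_cong)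
  then show ?thesis
    by (simp only:) (intro Ck_on_sum Ck_on_scaleR assms Ck_on_const finite)
qed

text \<open>Cramer's rule writes the solution of a linear system as a rational function of its
  coefficients.\<close>
lemma Ck_on_inverse_operator:
  fixes L :: "'a::real_normed_vector \<Rightarrow> real^'n \<Rightarrow> real^'n"
  assumes "open S" "\<And>p. p \<in> S \<Longrightarrow> linear (L p)" "\<And>p. p \<in> S \<Longrightarrow> bij (L p)"
    and "\<And>v. Ck_on k S (\<lambda>p. L p v)"
  shows "Ck_on k S (\<lambda>p. inv (L p) v)"
proof -
  let ?A = "\<lambda>p. matrix (L p)"
  have det0: "det (?A p) \<noteq> 0" if "p \<in> S" for p
    using assms(2,3)[OF that] by (metis bij_is_inj det_nz_iff_inj)
  have comp: "Ck_on k S (\<lambda>p. L p v $ i)" for v i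
    using Ck_on_bilinear[OF bounded_bilinear_inner assms(1) assms(4)[of v] Ck_on_const[of k S "axis i 1"]]
    by (simp add: inner_axis)
  let ?G = "\<lambda>p. \<chi> m. det (\<chi> i j. if j = m then v $ i else ?A p $ i $ j) * inverse (det (?A p))"
  have A: "Ck_on k S (\<lambda>p. ?A p $ i $ j)" for i j by (simp add: matrix_def comp)
  have "Ck_on k S ?G"
  proof (intro Ck_on_vec Ck_on_mult Ck_on_inverse Ck_on_det assms(1) A det0)
    show "Ck_on k S (\<lambda>p. (\<chi> i j. if j = m then v $ i else ?A p $ i $ j) $ i $ j)" for m i j
      using A[of i j] by (cases "j = m") (auto simp: Ck_on_const)
  qed auto
  moreover have "inv (L p) v = ?G p" if "p \<in> S" for p
  proof -
    have "?A p *v inv (L p) v = v"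
      using matrix_works[OF assms(2)[OF that, unfolded linear_matrix_vector_mul_eq[symmetric]]]
        assms(2,3)[OF that] by (simp add: bij_is_surj surj_f_inv_f)
    then show ?thesis using cramer[OF det0[OF that]] by (simp add: divide_inverse)
  qed
  ultimately show ?thesis
    using Ck_on_cong[OF assms(1), of "\<lambda>p. inv (L p) v" ?G k] by simp
qed

text \<open>The inverse function theorem for \<open>C\<^sup>1\<close> maps provides a differentiable inverse \<open>g\<close>.  Its
  derivative at \<open>y\<close> is the inverse of the derivative of \<open>f\<close> at \<open>g y\<close>, hence as often differentiable as \<open>g\<close>
  itself, so that \<open>g\<close> gains one order of differentiability at a time.\<close>
lemma smooth_local_inverse:
  fixes f :: "real^'n \<Rightarrow> real^'n"
  assumes "open S" "smooth_on S f" "p \<in> S" "inj (frechet_derivative f (at p))"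
  obtains V W g where "open V" "V \<subseteq> S" "p \<in> V" "open W" "f p \<in> W"
    "homeomorphism V W f g" "smooth_on W g"
proof -
  let ?D = "\<lambda>q. frechet_derivative f (at q)"
  define f' where "f' q = Blinfun (?D q)" for q
  have D: "(f has_derivative ?D q) (at q)" if "q \<in> S" for q
    using smooth_on_has_derivative[OF assms(2) that] .
  have f': "blinfun_apply (f' q) = ?D q" if "q \<in> S" for q
    unfolding f'_def using has_derivative_bounded_linear[OF D[OF that]]
    by (rule bounded_linear_Blinfun_apply)
  have 1: "(f has_derivative blinfun_apply (f' q)) (at q)" if "q \<in> S" for q
    using D[OF that] f'[OF that] by simp
  have 2: "continuous_on S f'"
  proof (rule continuous_on_blinfun_componentwise)
    fix i :: "real^'n"
    have "continuous_on S (\<lambda>q. ?D q i)"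
      by (intro smooth_on_imp_continuous_on smooth_on_derivative assms)
    then show "continuous_on S (\<lambda>q. f' q i)" using f' by (simp cong: continuous_on_cong)
  qed
  obtain L where L: "linear L" "L \<circ> ?D p = id"
    using linear_injective_left_inverse[OF has_derivative_linear[OF D] assms(4)] assms(3) by blast
  have 3: "Blinfun L o\<^sub>L f' p = id_blinfun"
    using L f'[OF assms(3)] linear_conv_bounded_linear[of L]
    by (intro blinfun_eqI) (auto simp: bounded_linear_Blinfun_apply fun_eq_iff)
  obtain V W g g' where g: "open V" "V \<subseteq> S" "p \<in> V" "open W" "f p \<in> W" "homeomorphism V W f g"
    "\<And>y. y \<in> W \<Longrightarrow> (g has_derivative g' y) (at y)"
    "\<And>y. y \<in> W \<Longrightarrow> g' y = inv (blinfun_apply (f' (g y)))"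
    "\<And>y. y \<in> W \<Longrightarrow> bij (blinfun_apply (f' (g y)))"
    using inverse_function_theorem[OF assms(1) 1 2 assms(3) 3] by blast
  have gV: "g y \<in> V" if "y \<in> W" for y using g(6) that by (auto simp: homeomorphism_def)
  have gS: "g y \<in> S" if "y \<in> W" for y using gV[OF that] g(2) by auto
  have "Ck_on k W g" for k
  proof (induction k)
    case 0
    then show ?case using g(6) by (simp add: homeomorphism_def)
  next
    case (Suc k)
    have "Ck_on k W (\<lambda>y. inv (?D (g y)) v)" for v
    proof (rule Ck_on_inverse_operator[OF g(4)])
      show "linear (?D (g y))" if "y \<in> W" for y using has_derivative_linear[OF D[OF gS[OF that]]] .
      show "bij (?D (g y))" if "y \<in> W" for y using g(9)[OF that] f'[OF gS[OF that]] by simp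
      show "Ck_on k W (\<lambda>y. ?D (g y) u)" for u
        using smooth_on_derivative[OF assms(2), of u] gS
        by (intro Ck_on_compose[OF g(4) _ Suc, of S "\<lambda>q. ?D q u"]) (auto simp: smooth_on_def)
    qed
    moreover have "(g has_derivative inv (?D (g y))) (at y)" if "y \<in> W" for y
      using g(7,8)[OF that] f'[OF gS[OF that]] by simp
    ultimately show ?case by (intro Ck_on_SucI[OF g(4), where f' = "\<lambda>y. inv (?D (g y))"]) auto
  qed
  then show ?thesis using that g(1-6) by (auto simp: smooth_on_def)
qed

section \<open>Squares, cross products and unit normals\<close>

lemma open_open_square: "open (open_square \<delta>)" and convex_open_square: "convex (open_square \<delta>)"
proof -
  have "open_square \<delta> = box (\<chi> i. - \<delta>) (\<chi> i. \<delta>)"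
    by (auto simp: open_square_def mem_box_cart abs_less_iff minus_less_iff)
  then show "open (open_square \<delta>)" "convex (open_square \<delta>)" by (auto simp: open_box convex_box)
qed

lemma open_square_subset_nhd:
  assumes "open W" "0 \<in> W"
  obtains \<delta> where "\<delta> > 0" "open_square \<delta> \<subseteq> W"
proof -
  obtain r where r: "r > 0" "ball 0 r \<subseteq> W" using assms openE by blast
  have "open_square (r/2) \<subseteq> ball 0 r"
  proof
    fix q :: "real^2" assume "q \<in> open_square (r/2)"
    then have "\<bar>q $ 1\<bar> < r/2" "\<bar>q $ 2\<bar> < r/2" by (auto simp: open_square_def)
    then show "q \<in> ball 0 r" using norm_le_l1_cart[of q] by (simp add: UNIV_2)
  qed
  then show ?thesis using that[of "r/2"] r by auto
qed

lemma has_derivative_vec_nth: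
  "(f has_derivative f') F \<Longrightarrow> ((\<lambda>q. f q $ i) has_derivative (\<lambda>v. f' v $ i)) F"
  by (rule bounded_linear.has_derivative[OF bounded_linear_vec_nth])

lemma smooth_on_vec_nth:
  fixes f :: "'a::real_normed_vector \<Rightarrow> real^'n"
  shows "open S \<Longrightarrow> smooth_on S f \<Longrightarrow> smooth_on S (\<lambda>q. f q $ i)"
  by (rule smooth_on_linear_image[OF bounded_linear_vec_nth])

lemma cross_parallel_normal:
  fixes n a b :: "real^3"
  assumes "n \<noteq> 0" "n \<bullet> a = 0" "n \<bullet> b = 0"
  obtains t where "cross3 a b = t *\<^sub>R n"
proof -
  have "cross3 n (cross3 a b) = (n \<bullet> b) *\<^sub>R a - (n \<bullet> a) *\<^sub>R b"
    by (simp add: cross3_simps forall_3)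
  then have "collinear {0, n, cross3 a b}" using assms by (simp flip: cross_eq_0)
  then have "cross3 a b = 0 \<or> (\<exists>t. cross3 a b = t *\<^sub>R n)" using \<open>n \<noteq> 0\<close> by (simp add: collinear_lemma)
  then show ?thesis using that by (metis scaleR_zero_left)
qed

lemma cross_nonzero:
  fixes a b :: "real^3"
  assumes indep: "\<And>s t. s *\<^sub>R a + t *\<^sub>R b = 0 \<Longrightarrow> s = 0 \<and> t = 0"
  shows "cross3 a b \<noteq> 0"
proof
  assume "cross3 a b = 0"
  then have "collinear {0, a, b}" by (simp add: cross_eq_0)
  then consider "a = 0" | "b = 0" | c where "b = c *\<^sub>R a" by (auto simp: collinear_lemma)
  then show False
  proof cases
    case 1 then show False using indep[of 1 0] by simp
  next
    case 2 then show False using indep[of 0 1] by simp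
  next
    case 3 then show False using indep[of "-c" 1] by simp
  qed
qed

text \<open>This turns injectivity of a derivative into the non-vanishing of a continuous real function, to
  which a connectedness argument applies.\<close>
lemma inner_cross_nonzero:
  fixes n a b :: "real^3"
  assumes "n \<noteq> 0" "n \<bullet> a = 0" "n \<bullet> b = 0"
    and indep: "\<And>s t. s *\<^sub>R a + t *\<^sub>R b = 0 \<Longrightarrow> s = 0 \<and> t = 0"
  shows "n \<bullet> cross3 a b \<noteq> 0"
proof -
  obtain t where "cross3 a b = t *\<^sub>R n" using cross_parallel_normal[OF assms(1-3)] .
  with cross_nonzero[OF indep] \<open>n \<noteq> 0\<close> show ?thesis by auto
qed

lemma linear_injective_partials_independent:
  fixes L :: "real^2 \<Rightarrow> 'a::real_vector"
  assumes "linear L" "inj L" "s *\<^sub>R L (axis 1 1) + t *\<^sub>R L (axis 2 1) = 0"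
  shows "s = 0 \<and> t = 0"
proof -
  have "L (s *\<^sub>R axis 1 1 + t *\<^sub>R axis 2 1) = L 0"
    using assms by (simp add: linear_add linear_scale linear_0)
  then have "s *\<^sub>R axis 1 1 + t *\<^sub>R (axis 2 1 :: real^2) = 0" by (rule injD[OF assms(2)])
  then show ?thesis by (simp add: vec_eq_iff forall_2 axis_def)
qed

lemma connected_real_nonzero_sign:
  fixes F :: "'a::topological_space \<Rightarrow> real"
  assumes "connected C" "continuous_on C F" "\<And>c. c \<in> C \<Longrightarrow> F c \<noteq> 0"
  shows "(\<forall>c\<in>C. F c > 0) \<or> (\<forall>c\<in>C. F c < 0)"
proof (rule ccontr)
  assume "\<not> ?thesis"
  then obtain c d where "c \<in> C" "d \<in> C" "F c \<le> 0" "F d \<ge> 0" by (meson not_le)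
  then have "0 \<in> F ` C"
    using connectedD_interval[OF connected_continuous_image[OF assms(2,1)], of "F c" "F d" 0] by auto
  then show False using assms(3) by auto
qed

text \<open>The symmetry of the second fundamental form: differentiating \<open>n \<bullet> Dx v = 0\<close> in the
  direction \<open>w\<close> turns \<open>Dn w \<bullet> Dx v\<close> into minus a second derivative of \<open>n p \<bullet> x\<close>.\<close>
lemma second_fundamental_form_symmetric:
  fixes x n :: "'a::real_normed_vector \<Rightarrow> 'b::euclidean_space"
  assumes "open S" "p \<in> S" "smooth_on S x" "smooth_on S n"
    and perp: "\<And>q v. q \<in> S \<Longrightarrow> n q \<bullet> frechet_derivative x (at q) v = 0"
  shows "frechet_derivative n (at p) w \<bullet> frechet_derivative x (at p) v =
    frechet_derivative n (at p) v \<bullet> frechet_derivative x (at p) w"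
proof -
  let ?f = "\<lambda>q. n p \<bullet> x q" and ?D = "\<lambda>q. frechet_derivative x (at q)"
  have sf: "smooth_on S ?f"
    by (rule smooth_on_linear_image[OF bounded_linear_inner_right assms(1,3)])
  have f': "frechet_derivative ?f (at q) u = n p \<bullet> ?D q u" if "q \<in> S" for q u
    using frechet_derivative_at[OF has_derivative_inner_right[OF smooth_on_has_derivative[OF assms(3) that]]]
    by (metis (no_types))
  have "frechet_derivative n (at p) w \<bullet> ?D p v =
    - frechet_derivative (\<lambda>q. frechet_derivative ?f (at q) v) (at p) w" for v w
  proof -
    have D2: "((\<lambda>q. ?D q v) has_derivative frechet_derivative (\<lambda>q. ?D q v) (at p)) (at p)"
      by (rule smooth_on_has_derivative[OF smooth_on_derivative[OF assms(3)] assms(2)])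
    have "((\<lambda>q. frechet_derivative ?f (at q) v) has_derivative
        (\<lambda>w. n p \<bullet> frechet_derivative (\<lambda>q. ?D q v) (at p) w)) (at p)"
      by (rule has_derivative_transform_within_open[OF has_derivative_inner_right[OF D2] assms(1,2)])
         (simp add: f')
    then have 1: "frechet_derivative (\<lambda>q. frechet_derivative ?f (at q) v) (at p) w =
        n p \<bullet> frechet_derivative (\<lambda>q. ?D q v) (at p) w"
      using frechet_derivative_at by metis
    have "((\<lambda>q. n q \<bullet> ?D q v) has_derivative (\<lambda>w. n p \<bullet> frechet_derivative (\<lambda>q. ?D q v) (at p) w +
        frechet_derivative n (at p) w \<bullet> ?D p v)) (at p)"
      by (intro has_derivative_inner D2 smooth_on_has_derivative[OF assms(4,2)])
    moreover have "((\<lambda>q. n q \<bullet> ?D q v) has_derivative (\<lambda>w. 0)) (at p)"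
      by (rule has_derivative_transform_within_open[OF has_derivative_const assms(1,2)]) (simp add: perp)
    ultimately have "n p \<bullet> frechet_derivative (\<lambda>q. ?D q v) (at p) w +
        frechet_derivative n (at p) w \<bullet> ?D p v = 0"
      using has_derivative_unique by (metis (no_types, lifting))
    then show ?thesis using 1 by simp
  qed
  then show ?thesis using second_derivative_symmetric[OF assms(1) sf assms(2), of v w] by metis
qed

lemma unit_field_derivative_orthogonal:
  fixes n :: "'a::real_normed_vector \<Rightarrow> 'b::real_inner"
  assumes "open S" "p \<in> S" "smooth_on S n" "\<And>q. q \<in> S \<Longrightarrow> norm (n q) = 1"
  shows "n p \<bullet> frechet_derivative n (at p) v = 0"
proof -
  note n' = smooth_on_has_derivative[OF assms(3,2)]
  have "((\<lambda>q. n q \<bullet> n q) has_derivative (\<lambda>v. n p \<bullet> frechet_derivative n (at p) v +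
      frechet_derivative n (at p) v \<bullet> n p)) (at p)"
    by (intro has_derivative_inner n')
  moreover have "((\<lambda>q. n q \<bullet> n q) has_derivative (\<lambda>v. 0)) (at p)"
    by (rule has_derivative_transform_within_open[OF has_derivative_const[of 1] assms(1,2)])
       (simp add: assms(4) flip: power2_norm_eq_inner)
  ultimately have "n p \<bullet> frechet_derivative n (at p) v + frechet_derivative n (at p) v \<bullet> n p = 0"
    using has_derivative_unique by (metis (no_types, lifting))
  then show ?thesis by (simp add: inner_commute)
qed

section \<open>Surfaces parametrised by \<open>x\<^sub>1\<close> and the slope of the normal\<close>

lemma vector_eq_axes: "vector [w, z] = w *\<^sub>R axis 1 1 + z *\<^sub>R (axis 2 1 :: real^2)"
  by (simp add: vec_eq_iff forall_2 axis_def)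

lemma orthogonal_field_partials:
  fixes y \<nu> :: "real^2 \<Rightarrow> real^3"
  assumes "open Q" "smooth_on Q y" "q \<in> Q"
    and y1: "\<And>q. q \<in> Q \<Longrightarrow> y q $ 1 = q $ 1"
    and \<nu>2: "\<nu> q $ 2 = - (q $ 2) * \<nu> q $ 3" and \<nu>3: "\<nu> q $ 3 > 0"
    and perp: "\<And>v. \<nu> q \<bullet> frechet_derivative y (at q) v = 0"
  shows "frechet_derivative y (at q) v $ 1 = v $ 1"
    and "frechet_derivative y (at q) (axis 2 1) $ 3 = q $ 2 * frechet_derivative y (at q) (axis 2 1) $ 2"
proof -
  have "((\<lambda>q. y q $ 1) has_derivative (\<lambda>v. frechet_derivative y (at q) v $ 1)) (at q)"
    by (intro has_derivative_vec_nth smooth_on_has_derivative[OF assms(2,3)])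
  moreover have "((\<lambda>q. y q $ 1) has_derivative (\<lambda>v. v $ 1)) (at q)"
    by (rule has_derivative_transform_within_open[OF _ assms(1,3), of "\<lambda>q. q $ 1"])
       (auto simp: y1 intro: has_derivative_vec_nth)
  ultimately show D1: "frechet_derivative y (at q) v $ 1 = v $ 1" for v
    using has_derivative_unique by metis
  let ?v = "frechet_derivative y (at q) (axis 2 1)"
  have "?v $ 1 = 0" using D1 by (simp add: axis_def)
  then have "\<nu> q $ 3 * (?v $ 3 - q $ 2 * ?v $ 2) = 0"
    using perp[of "axis 2 1"] \<nu>2 by (simp add: inner_vec_def sum_3 algebra_simps)
  then show "?v $ 3 = q $ 2 * ?v $ 2" using \<nu>3 by simp
qed

text \<open>Orthogonality to the normal says that the last two
  components of \<open>y\<close> satisfy \<open>dy\<^sub>3/dz = z dy\<^sub>2/dz\<close>; integrating in \<open>z\<close> from the axis \<open>z = 0\<close>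
  recovers both of them from \<open>\<lambda> = dy\<^sub>2/dz\<close> and from their values on the axis.\<close>
lemma eq_normal_form:
  fixes y \<nu> :: "real^2 \<Rightarrow> real^3"
  assumes "smooth_on (open_square \<delta>) y" "q \<in> open_square \<delta>"
    and y1: "\<And>q. q \<in> open_square \<delta> \<Longrightarrow> y q $ 1 = q $ 1"
    and \<nu>2: "\<And>q. q \<in> open_square \<delta> \<Longrightarrow> \<nu> q $ 2 = - (q $ 2) * \<nu> q $ 3"
    and \<nu>3: "\<And>q. q \<in> open_square \<delta> \<Longrightarrow> \<nu> q $ 3 > 0"
    and perp: "\<And>q v. q \<in> open_square \<delta> \<Longrightarrow> \<nu> q \<bullet> frechet_derivative y (at q) v = 0"
  shows "normal_form (\<lambda>q. frechet_derivative y (at q) (axis 2 1) $ 2)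
      (\<lambda>w. y (vector [w, 0]) $ 2) (\<lambda>w. y (vector [w, 0]) $ 3) q = y q"
proof -
  define w z where "w = q $ 1" and "z = q $ 2"
  have q: "q = vector [w, z]" by (simp add: w_def z_def vec_eq_iff forall_2)
  have wz: "\<bar>w\<bar> < \<delta>" "\<bar>z\<bar> < \<delta>" using assms(2) by (auto simp: open_square_def w_def z_def)
  let ?c = "\<lambda>t. vector [w, t] :: real^2"
  let ?dy = "\<lambda>t. frechet_derivative y (at (?c t)) (axis 2 1)"
  define J where "J = {min 0 z..max 0 z}"
  have c: "?c t \<in> open_square \<delta>" if "t \<in> J" for t
    using that wz by (auto simp: open_square_def forall_2 J_def)
  have c': "(?c has_vector_derivative axis 2 1) (at t)" for t
    unfolding vector_eq_axes by (auto intro!: derivative_eq_intros)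
  have dy: "((\<lambda>t. y (?c t) $ i) has_vector_derivative ?dy t $ i) (at t within J)" if "t \<in> J" for t i
  proof -
    have "((\<lambda>t. y (?c t)) has_vector_derivative ?dy t) (at t)"
      by (rule smooth_on_along_curve[where c = ?c, OF assms(1) c[OF that] c'])
    from bounded_linear.has_vector_derivative[OF bounded_linear_vec_nth this]
    show ?thesis by (rule has_vector_derivative_at_within)
  qed
  have cont: "continuous_on J (\<lambda>t. ?dy t $ i)" for i
  proof -
    have "continuous_on J ?c"
      using c' by (intro continuous_at_imp_continuous_on ballI has_vector_derivative_continuous)
    then have "continuous_on J ?dy"
      by (rule continuous_on_compose2[OF smooth_on_imp_continuous_on[OF smooth_on_derivative[OF assms(1)]]])
         (use c in auto)
    then show ?thesis by (rule continuous_on_component)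
  qed
  have int: "(LBINT t=0..z. ?dy t $ i) = y q $ i - y (?c 0) $ i" for i
    using interval_integral_FTC_finite[of 0 z "\<lambda>t. ?dy t $ i" "\<lambda>t. y (?c t) $ i"] cont[of i] dy[of _ i]
    unfolding J_def q by (simp add: zero_ereal_def)
  have dy3: "?dy t $ 3 = t * ?dy t $ 2" if "t \<in> J" for t
    using orthogonal_field_partials(2)[where y = y and \<nu> = \<nu> and q = "?c t", OF open_open_square assms(1) c[OF that] y1
        \<nu>2[OF c[OF that]] \<nu>3[OF c[OF that]] perp[OF c[OF that]]]
    by simp
  have "(LBINT t=0..z. t * ?dy t $ 2) = (LBINT t=0..z. ?dy t $ 3)"
    by (rule interval_integral_cong)
       (use dy3 in \<open>auto simp: einterval_def J_def min_def max_def zero_ereal_def split: if_splits\<close>)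
  then have "(LBINT t=0..z. t * ?dy t $ 2) = y q $ 3 - y (?c 0) $ 3" using int[of 3] by simp
  then show ?thesis
    using int[of 2] y1[OF assms(2)]
    by (simp add: normal_form_def Let_def vec_eq_iff forall_3 flip: w_def z_def)
qed

text \<open>The signed area density of \<open>y + l \<nu>\<close>, called \<open>F\<close> in the proof, is a continuous function
  of \<open>(q, l)\<close> that has no zero while \<open>0 < l < \<epsilon>\<close>, so by connectedness it has one sign there.  Its limit for \<open>l = 0\<close> is
  the signed area density of \<open>y\<close>, which is a positive multiple of \<open>dy\<^sub>2/dz\<close>.\<close>
lemma no_sign_change_if_parallels_immersive:
  fixes y \<nu> :: "real^2 \<Rightarrow> real^3"
  assumes "open Q" "convex Q" "smooth_on Q y" "smooth_on Q \<nu>" "0 < \<epsilon>"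
    and y1: "\<And>q. q \<in> Q \<Longrightarrow> y q $ 1 = q $ 1"
    and \<nu>2: "\<And>q. q \<in> Q \<Longrightarrow> \<nu> q $ 2 = - (q $ 2) * \<nu> q $ 3"
    and \<nu>3: "\<And>q. q \<in> Q \<Longrightarrow> \<nu> q $ 3 > 0"
    and unit: "\<And>q. q \<in> Q \<Longrightarrow> norm (\<nu> q) = 1"
    and perp: "\<And>q v. q \<in> Q \<Longrightarrow> \<nu> q \<bullet> frechet_derivative y (at q) v = 0"
    and inj: "\<And>q l. q \<in> Q \<Longrightarrow> 0 < l \<Longrightarrow> l < \<epsilon> \<Longrightarrow>
      inj (\<lambda>v. frechet_derivative y (at q) v + l *\<^sub>R frechet_derivative \<nu> (at q) v)"
  shows "no_sign_change_on Q (\<lambda>q. frechet_derivative y (at q) (axis 2 1) $ 2)"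
proof -
  let ?Y = "\<lambda>q. frechet_derivative y (at q)" and ?N = "\<lambda>q. frechet_derivative \<nu> (at q)"
  let ?e1 = "axis 1 1 :: real^2" and ?e2 = "axis 2 1 :: real^2"
  define F where "F q l = \<nu> q \<bullet> cross3 (?Y q ?e1 + l *\<^sub>R ?N q ?e1) (?Y q ?e2 + l *\<^sub>R ?N q ?e2)" for q l
  have nz: "F q l \<noteq> 0" if "q \<in> Q" "l \<in> {0<..<\<epsilon>}" for q l
    unfolding F_def
  proof (rule inner_cross_nonzero)
    show "\<nu> q \<noteq> 0" using \<nu>3[OF that(1)] by auto
    have "\<nu> q \<bullet> (?Y q v + l *\<^sub>R ?N q v) = 0" for v
      using perp[OF that(1)] unit_field_derivative_orthogonal[OF assms(1) that(1) assms(4) unit]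
      by (simp add: inner_add_right)
    then show "\<nu> q \<bullet> (?Y q ?e1 + l *\<^sub>R ?N q ?e1) = 0" "\<nu> q \<bullet> (?Y q ?e2 + l *\<^sub>R ?N q ?e2) = 0" by auto
    let ?L = "\<lambda>v. ?Y q v + l *\<^sub>R ?N q v"
    have lin: "linear (?Y q)" "linear (?N q)"
      using assms(3,4) that has_derivative_linear smooth_on_has_derivative by metis+
    have "linear ?L" using linear_compose_add[OF lin(1) linear_compose_scale_right[OF lin(2)]] .
    then show "s = 0 \<and> t = 0" if "s *\<^sub>R ?L ?e1 + t *\<^sub>R ?L ?e2 = 0" for s t
      using linear_injective_partials_independent[OF _ _ that] inj[OF \<open>q \<in> Q\<close>] \<open>l \<in> _\<close> by auto
  qed
  have cont: "continuous_on (Q \<times> UNIV) (\<lambda>c. h (fst c))" if "continuous_on Q h"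
    for h :: "real^2 \<Rightarrow> real^3"
    by (rule continuous_on_compose2[OF that continuous_on_fst[OF continuous_on_id]]) auto
  have "continuous_on (Q \<times> UNIV) (\<lambda>c. F (fst c) (snd c))"
    unfolding F_def
    by (intro continuous_on_inner continuous_on_cross continuous_on_add continuous_on_scaleR
        continuous_on_snd continuous_on_id cont smooth_on_imp_continuous_on smooth_on_derivative assms)
  then have "continuous_on (Q \<times> {0<..<\<epsilon>}) (\<lambda>c. F (fst c) (snd c))"
    by (rule continuous_on_subset) auto
  moreover have "connected (Q \<times> {0<..<\<epsilon>})"
    by (intro convex_connected convex_Times assms(2) convex_real_interval)
  ultimately have "(\<forall>c\<in>Q \<times> {0<..<\<epsilon>}. F (fst c) (snd c) > 0) \<or> (\<forall>c\<in>Q \<times> {0<..<\<epsilon>}. F (fst c) (snd c) < 0)"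
    using nz by (intro connected_real_nonzero_sign) auto
  then have "(\<forall>q\<in>Q. \<forall>l\<in>{0<..<\<epsilon>}. F q l \<ge> 0) \<or> (\<forall>q\<in>Q. \<forall>l\<in>{0<..<\<epsilon>}. F q l \<le> 0)"
    by (elim disjE) (simp_all add: ball_simps less_imp_le)
  moreover have lim: "((\<lambda>l. F q l) \<longlongrightarrow> F q 0) (at_right 0)" for q
  proof -
    have "continuous_on UNIV (F q)"
      unfolding F_def by (intro continuous_intros continuous_on_cross)
    then show ?thesis by (simp add: continuous_on_def filterlim_at_split)
  qed
  have ev: "\<forall>\<^sub>F l in at_right 0. l \<in> {0<..<\<epsilon>}"
    by (rule eventually_at_right_real[OF \<open>0 < \<epsilon>\<close>])
  have F0: "\<exists>r>0. F q 0 = r * ?Y q ?e2 $ 2" if q: "q \<in> Q" for q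
  proof -
    note D = orthogonal_field_partials[where y = y and \<nu> = \<nu> and q = q, OF assms(1,3) q y1 \<nu>2[OF q] \<nu>3[OF q] perp[OF q]]
    define a b where "a = ?Y q ?e1 $ 2" and "b = ?Y q ?e1 $ 3"
    have e1: "?Y q ?e1 $ 1 = 1" and e2: "?Y q ?e2 $ 1 = 0" using D(1) by (simp_all add: axis_def)
    \<comment> \<open>With \<open>y\<^sub>w = (1, a, b)\<close>, orthogonality determines \<open>\<nu>\<close> up to its third component:
      \<open>\<nu> = \<nu>\<^sub>3 (a z - b, - z, 1)\<close>.\<close>
    have \<nu>1: "\<nu> q $ 1 = \<nu> q $ 3 * (a * q $ 2 - b)"
      using perp[OF q, of ?e1] \<nu>2[OF q] e1 by (simp add: inner_vec_def sum_3 a_def b_def algebra_simps)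
    have "F q 0 = (\<nu> q $ 1 * (a * q $ 2 - b) - \<nu> q $ 2 * q $ 2 + \<nu> q $ 3) * ?Y q ?e2 $ 2"
      using e1 e2 D(2)
      by (simp add: F_def cross3_def inner_vec_def sum_3 algebra_simps flip: a_def b_def)
    also have "\<nu> q $ 1 * (a * q $ 2 - b) - \<nu> q $ 2 * q $ 2 + \<nu> q $ 3 =
        \<nu> q $ 3 * (1 + (q $ 2)\<^sup>2 + (a * q $ 2 - b)\<^sup>2)"
      unfolding \<nu>1 \<nu>2[OF q] by (simp add: power2_eq_square algebra_simps)
    finally have "F q 0 = (\<nu> q $ 3 * (1 + (q $ 2)\<^sup>2 + (a * q $ 2 - b)\<^sup>2)) * ?Y q ?e2 $ 2" .
    moreover have "\<nu> q $ 3 * (1 + (q $ 2)\<^sup>2 + (a * q $ 2 - b)\<^sup>2) > 0"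
      using \<nu>3[OF q] by (intro mult_pos_pos add_pos_nonneg) auto
    ultimately show ?thesis by blast
  qed
  ultimately show ?thesis
  proof (elim disjE)
    assume 1: "\<forall>q\<in>Q. \<forall>l\<in>{0<..<\<epsilon>}. F q l \<ge> 0"
    have "?Y q ?e2 $ 2 \<ge> 0" if "q \<in> Q" for q
    proof -
      have "F q 0 \<ge> 0"
        by (rule tendsto_lowerbound[OF lim _ trivial_limit_at_right_real])
           (rule eventually_mono[OF ev], use 1 that in auto)
      then show ?thesis using F0[OF that] by (auto simp: zero_le_mult_iff)
    qed
    then show ?thesis by (auto simp: no_sign_change_on_def)
  next
    assume 2: "\<forall>q\<in>Q. \<forall>l\<in>{0<..<\<epsilon>}. F q l \<le> 0"
    have "?Y q ?e2 $ 2 \<le> 0" if "q \<in> Q" for q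
    proof -
      have "F q 0 \<le> 0"
        by (rule tendsto_upperbound[OF lim _ trivial_limit_at_right_real])
           (rule eventually_mono[OF ev], use 2 that in auto)
      then show ?thesis using F0[OF that] by (auto simp: mult_le_0_iff)
    qed
    then show ?thesis by (auto simp: no_sign_change_on_def)
  qed
qed

section \<open>The change of parameters\<close>

lemma R_equivalent_subset:
  "R_equivalent S f T g p \<Longrightarrow> S \<subseteq> S' \<Longrightarrow> R_equivalent S' f T g p"
  unfolding R_equivalent_def by (meson order_trans)

text \<open>The functions \<open>x\<^sub>1\<close> and \<open>- n\<^sub>2 / n\<^sub>3\<close> are coordinates near \<open>0\<close>.  Indeed let both
  differentials vanish on \<open>u\<close>.  The first gives \<open>Dx u = 0\<close>, since \<open>Dx\<close> maps into the first axis.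
  The components of \<open>Dn u\<close> vanish as well: the first by symmetry of the second fundamental
  form, the second by assumption on \<open>u\<close>, the third because \<open>n\<close> has unit length.\<close>
lemma slope_coordinates:
  fixes x n :: "real^2 \<Rightarrow> real^3"
  assumes "open S" "0 \<in> S" "smooth_on S x" "smooth_on S n" "x 0 = 0" "n 0 = axis 3 1"
    and unit: "\<And>q. q \<in> S \<Longrightarrow> norm (n q) = 1"
    and perp: "\<And>q v. q \<in> S \<Longrightarrow> n q \<bullet> frechet_derivative x (at q) v = 0"
    and image: "\<And>v. frechet_derivative x (at 0) v $ 2 = 0"
    and nonzero: "frechet_derivative x (at 0) j \<noteq> 0"
    and immersive: "\<And>u. frechet_derivative x (at 0) u = 0 \<Longrightarrow> frechet_derivative n (at 0) u = 0 \<Longrightarrow> u = 0"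
  shows "\<exists>V W h (g :: real^2 \<Rightarrow> real^2). open V \<and> V \<subseteq> S \<and> 0 \<in> V \<and> open W \<and> 0 \<in> W \<and> h 0 = 0 \<and>
    homeomorphism V W h g \<and> smooth_on V h \<and> smooth_on W g \<and>
    (\<forall>q\<in>V. h q $ 1 = x q $ 1 \<and> n q $ 2 = - (h q $ 2) * n q $ 3 \<and> n q $ 3 > 0)"
proof -
  let ?X = "frechet_derivative x (at 0)" and ?N = "frechet_derivative n (at 0)"
  define S' where "S' = S \<inter> (\<lambda>q. n q $ 3) -` {0<..}"
  have "open S'"
    unfolding S'_def using assms(1,4)
    by (intro continuous_open_preimage smooth_on_imp_continuous_on smooth_on_vec_nth) auto
  have "0 \<in> S'" using assms(2,6) by (simp add: S'_def)
  have sx: "smooth_on S' x" and sn: "smooth_on S' n"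
    using assms(3,4) by (auto simp: S'_def intro: smooth_on_subset)
  define h :: "real^2 \<Rightarrow> real^2"
    where "h q = vector [x q $ 1, (-1) * (n q $ 2 * inverse (n q $ 3))]" for q
  have sh: "smooth_on S' h"
    unfolding h_def vector_eq_axes
    by (intro smooth_on_add smooth_on_bilinear[OF bounded_bilinear_scaleR]
        smooth_on_bilinear[OF bounded_bilinear_mult] smooth_on_inverse smooth_on_const
        smooth_on_vec_nth sx sn \<open>open S'\<close>) (auto simp: S'_def)
  have h1: "h q $ 1 = x q $ 1" for q by (simp add: h_def)
  have h2: "n q $ 2 = - (h q $ 2) * n q $ 3" if "q \<in> S'" for q
    using that by (simp add: h_def S'_def)
  have h0: "h 0 = 0" using assms(5,6) by (simp add: h_def vec_eq_iff forall_2 axis_def)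
  let ?H = "frechet_derivative h (at 0)"
  have X: "(x has_derivative ?X) (at 0)" and N: "(n has_derivative ?N) (at 0)"
    and H: "(h has_derivative ?H) (at 0)"
    using smooth_on_has_derivative sx sn sh \<open>0 \<in> S'\<close> by blast+
  have H1: "?H u $ 1 = ?X u $ 1" for u
    using has_derivative_unique[OF has_derivative_vec_nth[OF H, of 1]] has_derivative_vec_nth[OF X, of 1]
    unfolding h1 by metis
  \<comment> \<open>Differentiate \<open>n\<^sub>2 = - h\<^sub>2 n\<^sub>3\<close> at \<open>0\<close>, where \<open>h\<^sub>2 = 0\<close> and \<open>n\<^sub>3 = 1\<close>.\<close>
  have H2: "?N u $ 2 = - (?H u $ 2)" for u
  proof -
    have "((\<lambda>q. - (h q $ 2) * n q $ 3) has_derivative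
        (\<lambda>u. - (h 0 $ 2) * ?N u $ 3 + - (?H u $ 2) * n 0 $ 3)) (at 0)"
      by (intro has_derivative_mult has_derivative_minus has_derivative_vec_nth H N)
    then have "((\<lambda>q. - (h q $ 2) * n q $ 3) has_derivative (\<lambda>u. - (?H u $ 2))) (at 0)"
      using h0 assms(6) by simp
    then have "((\<lambda>q. n q $ 2) has_derivative (\<lambda>u. - (?H u $ 2))) (at 0)"
      by (rule has_derivative_transform_within_open[OF _ \<open>open S'\<close> \<open>0 \<in> S'\<close>]) (simp add: h2)
    then show ?thesis using has_derivative_unique[OF has_derivative_vec_nth[OF N, of 2]] by metis
  qed
  have X3: "?X v $ 3 = 0" for v using perp[OF assms(2), of v] assms(6) by (simp add: inner_axis')
  have Xj: "?X j $ 1 \<noteq> 0" using nonzero image X3 by (auto simp: vec_eq_iff forall_3)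
  have "inj ?H"
  proof (rule linear_injective_0[THEN iffD2, OF has_derivative_linear[OF H]], intro allI impI)
    fix u assume u: "?H u = 0"
    have Xu: "?X u = 0" using H1[of u] u image X3 by (simp add: vec_eq_iff forall_3)
    have N2: "?N u $ 2 = 0" using H2[of u] u by simp
    have N3: "?N u $ 3 = 0"
      using unit_field_derivative_orthogonal[OF assms(1,2,4) unit, of u] assms(6) by (simp add: inner_axis')
    have "?N u \<bullet> ?X j = 0"
      using second_fundamental_form_symmetric[OF assms(1,2,3,4) perp, of u j] Xu by simp
    then have "?N u $ 1 = 0" using Xj image X3 by (simp add: inner_vec_def sum_3)
    then have "?N u = 0" using N2 N3 by (simp add: vec_eq_iff forall_3)
    then show "u = 0" using immersive Xu by blast
  qed
  then obtain V W g where g: "open V" "V \<subseteq> S'" "0 \<in> V" "open W" "h 0 \<in> W"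
      "homeomorphism V W h g" "smooth_on W g"
    using smooth_local_inverse[OF \<open>open S'\<close> sh \<open>0 \<in> S'\<close>] by blast
  have "V \<subseteq> S" using g(2) by (auto simp: S'_def)
  moreover have "smooth_on V h" using sh g(2) by (rule smooth_on_subset)
  moreover have "\<forall>q\<in>V. h q $ 1 = x q $ 1 \<and> n q $ 2 = - (h q $ 2) * n q $ 3 \<and> n q $ 3 > 0"
    using h1 h2 g(2) by (auto simp: S'_def)
  ultimately show ?thesis using g h0 by metis
qed

text \<open>This is the result for germs in adapted position, with tangent line and normal at \<open>0\<close> along
  the first and the third axis.  The change of parameters is the inverse \<open>g\<close> of the slope
  coordinates, and all hypotheses on \<open>(x, n)\<close> are pulled back along it.\<close>
lemma normal_form_of_adapted_germ:
  fixes x n :: "real^2 \<Rightarrow> real^3"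
  assumes "open S" "0 \<in> S" "smooth_on S x" "smooth_on S n" "x 0 = 0" "n 0 = axis 3 1"
    and unit: "\<And>q. q \<in> S \<Longrightarrow> norm (n q) = 1"
    and perp: "\<And>q v. q \<in> S \<Longrightarrow> n q \<bullet> frechet_derivative x (at q) v = 0"
    and image: "\<And>v. frechet_derivative x (at 0) v $ 2 = 0"
    and nonzero: "frechet_derivative x (at 0) j \<noteq> 0"
    and immersive: "\<And>u. frechet_derivative x (at 0) u = 0 \<Longrightarrow> frechet_derivative n (at 0) u = 0 \<Longrightarrow> u = 0"
    and "0 < \<epsilon>"
    and parallels: "\<And>q l. q \<in> S \<Longrightarrow> 0 < l \<Longrightarrow> l < \<epsilon> \<Longrightarrow>
      inj (\<lambda>v. frechet_derivative x (at q) v + l *\<^sub>R frechet_derivative n (at q) v)"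
  shows "\<exists>\<delta> lam f1 f2. \<delta> > 0 \<and> smooth_on (open_square \<delta>) lam \<and>
    smooth_on {-\<delta><..<\<delta>} f1 \<and> smooth_on {-\<delta><..<\<delta>} f2 \<and> lam 0 = 0 \<and>
    no_sign_change_on (open_square \<delta>) lam \<and>
    R_equivalent S x (open_square \<delta>) (normal_form lam f1 f2) 0"
proof -
  obtain V W and h g :: "real^2 \<Rightarrow> real^2"
    where V: "open V" "V \<subseteq> S" "0 \<in> V" and W: "open W" "0 \<in> W" and h0: "h 0 = 0"
      and hom: "homeomorphism V W h g" and sh: "smooth_on V h" and sg: "smooth_on W g"
      and h: "\<forall>q\<in>V. h q $ 1 = x q $ 1 \<and> n q $ 2 = - (h q $ 2) * n q $ 3 \<and> n q $ 3 > 0"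
    by (atomize_elim, rule slope_coordinates[OF assms(1-11)])
  obtain \<delta> where "\<delta> > 0" and \<delta>W: "open_square \<delta> \<subseteq> W" using open_square_subset_nhd[OF W] .
  let ?Q = "open_square \<delta>"
  have "0 \<in> ?Q" using \<open>\<delta> > 0\<close> by (simp add: open_square_def)
  note oQ = open_open_square[of \<delta>]
  have gV: "g q \<in> V" and hg: "h (g q) = q" if "q \<in> ?Q" for q
    using hom that \<delta>W by (auto simp: homeomorphism_def)
  have gS: "g q \<in> S" if "q \<in> ?Q" for q using gV[OF that] V(2) by auto
  have g0: "g 0 = 0" using hom V(3) h0 by (metis homeomorphism_def)
  have sgQ: "smooth_on ?Q g" using sg \<delta>W by (rule smooth_on_subset)
  define y \<nu> where "y q = x (g q)" and "\<nu> q = n (g q)" for q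
  have sy: "smooth_on ?Q y" and s\<nu>: "smooth_on ?Q \<nu>"
    unfolding y_def \<nu>_def using gS
    by (auto intro!: smooth_on_compose[OF oQ _ sgQ] assms(3,4))
  let ?X = "\<lambda>q. frechet_derivative x (at q)" and ?N = "\<lambda>q. frechet_derivative n (at q)"
  let ?Y = "\<lambda>q. frechet_derivative y (at q)" and ?G = "\<lambda>q. frechet_derivative g (at q)"
  have G: "(g has_derivative ?G q) (at q)" if "q \<in> ?Q" for q
    using smooth_on_has_derivative[OF sgQ that] .
  have Y: "?Y q v = ?X (g q) (?G q v)" if "q \<in> ?Q" for q v
    using frechet_derivative_at[OF has_derivative_compose[of g "?G q" q UNIV x "?X (g q)",
          OF G[OF that] smooth_on_has_derivative[OF assms(3) gS[OF that]]]]
    unfolding y_def by metis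
  have N: "frechet_derivative \<nu> (at q) v = ?N (g q) (?G q v)" if "q \<in> ?Q" for q v
    using frechet_derivative_at[OF has_derivative_compose[of g "?G q" q UNIV n "?N (g q)",
          OF G[OF that] smooth_on_has_derivative[OF assms(4) gS[OF that]]]]
    unfolding \<nu>_def by metis
  have injG: "inj (?G q)" if "q \<in> ?Q" for q
  proof -
    have "((\<lambda>q. h (g q)) has_derivative (\<lambda>v. frechet_derivative h (at (g q)) (?G q v))) (at q)"
      by (rule has_derivative_compose[of g "?G q" q UNIV h,
            OF G[OF that] smooth_on_has_derivative[OF sh gV[OF that]]])
    moreover have "((\<lambda>q. h (g q)) has_derivative (\<lambda>v. v)) (at q)"
      by (rule has_derivative_transform_within_open[OF has_derivative_ident oQ that]) (simp add: hg)
    ultimately have "(\<lambda>v. frechet_derivative h (at (g q)) (?G q v)) = (\<lambda>v. v)"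
      by (rule has_derivative_unique)
    then show ?thesis by (metis injI)
  qed
  have y1: "y q $ 1 = q $ 1" and \<nu>2: "\<nu> q $ 2 = - (q $ 2) * \<nu> q $ 3" and \<nu>3: "\<nu> q $ 3 > 0"
    if "q \<in> ?Q" for q
    using bspec[OF h gV[OF that]] hg[OF that] by (simp_all add: y_def \<nu>_def)
  have unit\<nu>: "norm (\<nu> q) = 1" and perp\<nu>: "\<nu> q \<bullet> ?Y q v = 0" if "q \<in> ?Q" for q v
    using unit perp gS[OF that] Y[OF that] by (simp_all add: \<nu>_def)
  define lam where "lam q = ?Y q (axis 2 1) $ 2" for q
  define f where "f i w = y (vector [w, 0]) $ i" for i w
  have slam: "smooth_on ?Q lam"
    unfolding lam_def by (intro smooth_on_vec_nth smooth_on_derivative oQ sy)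
  have sf: "smooth_on {-\<delta><..<\<delta>} (f i)" for i
  proof -
    have "smooth_on {-\<delta><..<\<delta>} (\<lambda>w. y (w *\<^sub>R axis 1 1))"
      by (rule smooth_on_compose[OF _ sy smooth_on_bounded_linear[OF bounded_linear_scaleR_left]])
         (auto simp: open_square_def forall_2 axis_def)
    then have "smooth_on {-\<delta><..<\<delta>} (\<lambda>w. y (w *\<^sub>R axis 1 1) $ i)"
      by (rule smooth_on_vec_nth[OF open_greaterThanLessThan])
    then show ?thesis unfolding f_def vector_eq_axes by simp
  qed
  have "lam 0 = 0" using Y[OF \<open>0 \<in> ?Q\<close>] image by (simp add: lam_def g0)
  moreover have "no_sign_change_on ?Q lam"
    unfolding lam_def
  proof (rule no_sign_change_if_parallels_immersive[OF oQ convex_open_square sy s\<nu> \<open>0 < \<epsilon>\<close>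
        y1 \<nu>2 \<nu>3 unit\<nu> perp\<nu>])
    fix q l assume "q \<in> ?Q" "0 < l" "l < \<epsilon>"
    then show "inj (\<lambda>v. ?Y q v + l *\<^sub>R frechet_derivative \<nu> (at q) v)"
      using inj_compose[OF parallels[OF gS] injG] by (simp add: Y N o_def)
  qed
  moreover have "R_equivalent S x ?Q (normal_form lam (f 2) (f 3)) 0"
    unfolding R_equivalent_def
  proof (intro exI conjI ballI)
    have "g ` ?Q = V \<inter> h -` ?Q"
      using hom \<delta>W by (force simp: homeomorphism_def image_iff)
    then show "open (g ` ?Q)"
      using continuous_open_preimage[OF smooth_on_imp_continuous_on[OF sh] V(1) oQ] by simp
    show "0 \<in> g ` ?Q" using g0 \<open>0 \<in> ?Q\<close> by (metis imageI)
    show "g ` ?Q \<subseteq> S" using gS by auto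
    show "diffeomorphism_on ?Q (g ` ?Q) g"
      unfolding diffeomorphism_on_def
    proof (intro exI conjI sgQ)
      show "homeomorphism ?Q (g ` ?Q) g h"
        using homeomorphism_of_subsets[OF homeomorphism_symD[OF hom] \<delta>W] gV by auto
      show "smooth_on (g ` ?Q) h" by (rule smooth_on_subset[OF sh]) (use gV in auto)
    qed
    show "normal_form lam (f 2) (f 3) q = x (g q)" if "q \<in> ?Q" for q
      using eq_normal_form[OF sy that y1 \<nu>2 \<nu>3 perp\<nu>]
      unfolding lam_def[abs_def] f_def[abs_def] by (simp add: y_def)
  qed (use oQ \<open>0 \<in> ?Q\<close> g0 in auto)
  ultimately show ?thesis using \<open>\<delta> > 0\<close> slam sf by blast
qed

section \<open>Reduction to the adapted position\<close>

lemma adapted_isometry: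
  fixes a m :: "real^3"
  assumes "norm a = 1" "norm m = 1" "m \<bullet> a = 0"
  obtains T :: "real^3 \<Rightarrow> real^3" where "orthogonal_transformation T" "T a = axis 1 1" "T m = axis 3 1"
proof -
  let ?c = "cross3 m a"
  define A :: "real^3^3" where "A = vector [a, ?c, m]"
  have A: "A $ 1 = a" "A $ 2 = ?c" "A $ 3 = m" by (simp_all add: A_def)
  have "(norm ?c)\<^sup>2 = 1" using norm_cross_dot[of m a] assms by simp
  then have c: "norm ?c = 1" using abs_square_eq_1[of "norm ?c"] by simp
  have "orthogonal_matrix A"
    unfolding orthogonal_matrix_orthonormal_rows
    using assms c
    by (auto simp: forall_3 row_def A orthogonal_def dot_cross_self inner_commute)
  then have "orthogonal_transformation ((*v) A)"
    by (simp add: orthogonal_transformation_matrix)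
  moreover have "A *v a = axis 1 1" "A *v m = axis 3 1"
    using assms
    by (simp_all add: vec_eq_iff forall_3 matrix_vector_mul_component A dot_cross_self axis_def
        inner_commute norm_eq_1)
  ultimately show ?thesis using that by blast
qed

lemma rank_one_image:
  fixes L :: "real^'n \<Rightarrow> real^'m"
  assumes "linear L" "rank (matrix L) = 1"
  obtains a where "norm a = 1" "range L = range (\<lambda>c. c *\<^sub>R a)"
proof -
  have "(*v) (matrix L) = L" using assms(1) by (auto simp: fun_eq_iff matrix_works)
  then have dim: "dim (range L) = 1" using assms(2) rank_dim_range[of "matrix L"] by simp
  obtain B where B: "B \<subseteq> range L" "independent B" "range L \<subseteq> span B" "card B = dim (range L)"
    using basis_exists by blast
  then obtain b where b: "B = {b}" using dim card_1_singletonE by metis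
  have sub: "subspace (range L)" using assms(1) by (simp add: linear_subspace_image)
  have "b \<noteq> 0" using B(2) b by (auto simp: dependent_zero)
  define a where "a = b /\<^sub>R norm b"
  have a: "norm a = 1" using \<open>b \<noteq> 0\<close> by (simp add: a_def)
  have "range L = span {b}" using B b span_minimal[OF _ sub, of B] by auto
  also have "\<dots> = range (\<lambda>c. c *\<^sub>R a)"
    unfolding span_singleton
  proof (intro subset_antisym image_subsetI)
    show "c *\<^sub>R b \<in> range (\<lambda>c. c *\<^sub>R a)" for c
      by (rule range_eqI[of _ _ "c * norm b"]) (simp add: a_def \<open>b \<noteq> 0\<close>)
    show "c *\<^sub>R a \<in> range (\<lambda>c. c *\<^sub>R b)" for c
      by (rule range_eqI[of _ _ "c / norm b"]) (simp add: a_def divide_inverse)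
  qed
  finally show ?thesis using that a by blast
qed

lemma unit_normal_on_perp:
  assumes "unit_normal_on V x n" "smooth_on V x" "q \<in> V"
  shows "n q \<bullet> frechet_derivative x (at q) v = 0"
proof -
  let ?D = "frechet_derivative x (at q)"
  have lin: "linear ?D"
    using has_derivative_linear[OF smooth_on_has_derivative[OF assms(2,3)]] .
  have v: "v = v $ 1 *\<^sub>R axis 1 1 + v $ 2 *\<^sub>R axis 2 1"
    by (simp add: vec_eq_iff forall_2 axis_def)
  have "?D v = v $ 1 *\<^sub>R ?D (axis 1 1) + v $ 2 *\<^sub>R ?D (axis 2 1)"
    by (subst v) (simp only: linear_add[OF lin] linear_scale[OF lin])
  then show ?thesis using assms(1,3) by (simp add: unit_normal_on_def inner_add_right)
qed

text \<open>At immersive points both normals span the orthogonal complement of the tangent plane; since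
  these points are dense, \<open>(n \<bullet> n')\<^sup>2 = 1\<close> everywhere by continuity.\<close>
lemma unit_normals_agree_up_to_sign:
  assumes "open V" "V \<subseteq> U" "smooth_on V x" "unit_normal_on V x n" "unit_normal_on V x n'"
    and "proper_on U x" "q \<in> V"
  shows "(n q \<bullet> n' q)\<^sup>2 = 1"
proof -
  have sing: "\<not> immersive_at x q" if q: "q \<in> V" "(n q \<bullet> n' q)\<^sup>2 \<noteq> 1" for q
  proof
    let ?D = "frechet_derivative x (at q)"
    let ?a = "?D (axis 1 1)" and ?b = "?D (axis 2 1)"
    assume "immersive_at x q"
    moreover have "linear ?D"
      using has_derivative_linear[OF smooth_on_has_derivative[OF assms(3) q(1)]] .
    ultimately have c: "cross3 ?a ?b \<noteq> 0"
      using linear_injective_partials_independent by (intro cross_nonzero) (auto simp: immersive_at_def)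
    have unit: "norm (n q) = 1" "norm (n' q) = 1"
      using assms(4,5) q(1) by (auto simp: unit_normal_on_def)
    then have nz: "n q \<noteq> 0" "n' q \<noteq> 0" by auto
    obtain t where t: "cross3 ?a ?b = t *\<^sub>R n q"
      by (rule cross_parallel_normal[OF nz(1) unit_normal_on_perp[OF assms(4,3) q(1)]
            unit_normal_on_perp[OF assms(4,3) q(1)]])
    obtain t' where t': "cross3 ?a ?b = t' *\<^sub>R n' q"
      by (rule cross_parallel_normal[OF nz(2) unit_normal_on_perp[OF assms(5,3) q(1)]
            unit_normal_on_perp[OF assms(5,3) q(1)]])
    have "t\<^sup>2 = (norm (cross3 ?a ?b))\<^sup>2" unfolding t using unit by simp
    moreover have "t'\<^sup>2 = (norm (cross3 ?a ?b))\<^sup>2" unfolding t' using unit by simp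
    moreover have "t * (n q \<bullet> n' q) = t'"
      using arg_cong[OF trans[OF t[symmetric] t'], of "\<lambda>v. v \<bullet> n' q"] unit
      by (simp add: norm_eq_1)
    ultimately have "t\<^sup>2 * (n q \<bullet> n' q)\<^sup>2 = t\<^sup>2" by (metis power_mult_distrib)
    moreover have "t \<noteq> 0" using c t by auto
    ultimately show False using q(2) by simp
  qed
  have "continuous_on V (\<lambda>q. (n q \<bullet> n' q)\<^sup>2)"
    using assms(4,5)
    by (intro continuous_on_power continuous_on_inner smooth_on_imp_continuous_on) (auto simp: unit_normal_on_def)
  then have "open (V \<inter> (\<lambda>q. (n q \<bullet> n' q)\<^sup>2) -` (- {1}))"
    by (rule continuous_open_preimage[OF _ assms(1)]) auto
  moreover have "V \<inter> (\<lambda>q. (n q \<bullet> n' q)\<^sup>2) -` (- {1}) \<subseteq> singular_set U x"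
    using sing assms(2) by (auto simp: singular_set_def)
  ultimately have "V \<inter> (\<lambda>q. (n q \<bullet> n' q)\<^sup>2) -` (- {1}) = {}"
    using assms(6) interior_maximal unfolding proper_on_def by blast
  then show ?thesis using assms(7) by auto
qed

text \<open>The definition of a wavefront lets the normal along which it is immersive vary from point
  to point.  In \<open>n' = (n \<bullet> n') n\<close> the factor has square one and hence vanishing derivative.\<close>
lemma wavefront_immersive_with_normal:
  assumes "wavefront_on U x" "proper_on U x" "unit_normal_on U x n" "p \<in> U"
    and Xu: "frechet_derivative x (at p) u = 0" and Nu: "frechet_derivative n (at p) u = 0"
  shows "u = 0"
proof -
  obtain V n' where V: "open V" "p \<in> V" "V \<subseteq> U" and n': "unit_normal_on V x n'"
    and imm: "immersive_at (\<lambda>r. (x r, n' r)) p"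
    using assms(1,4) unfolding wavefront_on_def by blast
  have sx: "smooth_on V x" using assms(1) V(3) by (auto simp: wavefront_on_def intro: smooth_on_subset)
  have n: "unit_normal_on V x n"
    using assms(3) V(3) by (auto simp: unit_normal_on_def intro: smooth_on_subset)
  have sn: "smooth_on V n" and sn': "smooth_on V n'" using n n' by (auto simp: unit_normal_on_def)
  define s where "s q = n q \<bullet> n' q" for q
  have ss: "smooth_on V s"
    unfolding s_def by (intro smooth_on_bilinear[OF bounded_bilinear_inner] V sn sn')
  have s2: "(s q)\<^sup>2 = 1" if "q \<in> V" for q
    unfolding s_def by (rule unit_normals_agree_up_to_sign[OF V(1,3) sx n n' assms(2) that])
  have eq: "n' q = s q *\<^sub>R n q" if "q \<in> V" for q
  proof -
    have "norm (n q) = 1" "norm (n' q) = 1" using n n' that by (auto simp: unit_normal_on_def)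
    then have "(n' q - s q *\<^sub>R n q) \<bullet> (n' q - s q *\<^sub>R n q) = 1 - (s q)\<^sup>2"
      by (simp add: inner_diff_left inner_diff_right norm_eq_1 inner_commute s_def power2_eq_square)
    then show ?thesis using s2[OF that] by simp
  qed
  let ?S = "frechet_derivative s (at p)" and ?X = "frechet_derivative x (at p)"
    and ?N = "frechet_derivative n (at p)"
  have S: "(s has_derivative ?S) (at p)" and N: "(n has_derivative ?N) (at p)"
    and X: "(x has_derivative ?X) (at p)"
    using smooth_on_has_derivative ss sn sx V(2) by blast+
  have 1: "((\<lambda>q. s q * s q) has_derivative (\<lambda>u. s p * ?S u + ?S u * s p)) (at p)"
    by (intro has_derivative_mult S)
  have 2: "((\<lambda>q. s q * s q) has_derivative (\<lambda>u. 0)) (at p)"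
    by (rule has_derivative_transform_within_open[OF has_derivative_const[of 1] V(1,2)])
       (use s2 in \<open>simp add: power2_eq_square\<close>)
  have "s p * ?S u + ?S u * s p = 0" using fun_cong[OF has_derivative_unique[OF 1 2]] .
  then have Su: "?S u = 0" using s2[OF V(2)] by auto
  have "(n' has_derivative (\<lambda>u. s p *\<^sub>R ?N u + ?S u *\<^sub>R n p)) (at p)"
    by (rule has_derivative_transform_within_open[OF has_derivative_scaleR[OF S N] V(1,2)])
       (simp add: eq)
  from has_derivative_Pair[OF X this]
  have "frechet_derivative (\<lambda>r. (x r, n' r)) (at p) = (\<lambda>u. (?X u, s p *\<^sub>R ?N u + ?S u *\<^sub>R n p))"
    by (rule frechet_derivative_at[symmetric])
  then have inj: "inj (\<lambda>u. (?X u, s p *\<^sub>R ?N u + ?S u *\<^sub>R n p))"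
    using imm by (simp add: immersive_at_def)
  have "linear ?X" "linear ?N" "linear ?S" using X N S has_derivative_linear by auto
  then have "(?X 0, s p *\<^sub>R ?N 0 + ?S 0 *\<^sub>R n p) = (?X u, s p *\<^sub>R ?N u + ?S u *\<^sub>R n p)"
    using Xu Nu Su by (simp add: linear_0)
  then show ?thesis using injD[OF inj] by metis
qed

lemma rank_jacobian_eq_2_imp_inj:
  fixes f :: "real^2 \<Rightarrow> real^'m"
  assumes "(f has_derivative f') (at q)" "rank (jacobian f (at q)) = 2"
  shows "inj f'"
proof -
  have "jacobian f (at q) = matrix f'"
    using frechet_derivative_at[OF assms(1)] by (simp add: jacobian_def)
  moreover have "(*v) (matrix f') = f'"
    using has_derivative_linear[OF assms(1)] by (auto simp: fun_eq_iff matrix_works)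
  ultimately show ?thesis
    using assms(2) full_rank_injective[of "jacobian f (at q)"] by simp
qed

text \<open>Reversing the normal reduces the case of negative distances to that of positive ones.\<close>
lemma parallelly_smoothable_cases:
  assumes "smooth_on U x" "smooth_on U n" "parallelly_smoothable_at U x n p"
  obtains V \<epsilon> s where "open V" "p \<in> V" "V \<subseteq> U" "0 < \<epsilon>" "s = 1 \<or> s = (-1::real)"
    "\<forall>q\<in>V. \<forall>l. 0 < l \<and> l < \<epsilon> \<longrightarrow>
      inj (\<lambda>v. frechet_derivative x (at q) v + l *\<^sub>R s *\<^sub>R frechet_derivative n (at q) v)"
proof -
  obtain \<epsilon> V where V: "\<epsilon> > 0" "open V" "p \<in> V" "V \<subseteq> U" and
    rank: "(\<forall>q\<in>V. \<forall>l\<in>{0<..<\<epsilon>}. rank (jacobian (\<lambda>r. x r + l *\<^sub>R n r) (at q)) = 2) \<or>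
      (\<forall>q\<in>V. \<forall>l\<in>{-\<epsilon><..<0}. rank (jacobian (\<lambda>r. x r + l *\<^sub>R n r) (at q)) = 2)"
    using assms(3) unfolding parallelly_smoothable_at_def by blast
  have D: "((\<lambda>r. x r + l *\<^sub>R n r) has_derivative
      (\<lambda>v. frechet_derivative x (at q) v + l *\<^sub>R frechet_derivative n (at q) v)) (at q)" if "q \<in> V" for q l
    using smooth_on_subset[OF assms(1) V(4)] smooth_on_subset[OF assms(2) V(4)] that
    by (intro has_derivative_add has_derivative_scaleR_right smooth_on_has_derivative)
  from rank show ?thesis
  proof
    assume r: "\<forall>q\<in>V. \<forall>l\<in>{0<..<\<epsilon>}. rank (jacobian (\<lambda>r. x r + l *\<^sub>R n r) (at q)) = 2"
    have "inj (\<lambda>v. frechet_derivative x (at q) v + l *\<^sub>R frechet_derivative n (at q) v)"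
      if "q \<in> V" "0 < l" "l < \<epsilon>" for q l
      using r that by (intro rank_jacobian_eq_2_imp_inj[OF D]) auto
    then show ?thesis by (intro that[OF V(2-4,1), of 1]) simp_all
  next
    assume r: "\<forall>q\<in>V. \<forall>l\<in>{-\<epsilon><..<0}. rank (jacobian (\<lambda>r. x r + l *\<^sub>R n r) (at q)) = 2"
    have "inj (\<lambda>v. frechet_derivative x (at q) v + (- l) *\<^sub>R frechet_derivative n (at q) v)"
      if "q \<in> V" "0 < l" "l < \<epsilon>" for q l
      by (rule rank_jacobian_eq_2_imp_inj[OF D[OF that(1)]])
        (use bspec[OF bspec[OF r that(1)], of "- l"] that in simp)
    then show ?thesis by (intro that[OF V(2-4,1), of "-1"]) simp_all
  qed
qed

theorem corollary4p1:
  fixes U :: "(real^2) set" and x n :: "real^2 \<Rightarrow> real^3"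
  assumes "open U" and "0 \<in> U"
    and "wavefront_on U x" and "x 0 = 0"
    and "unit_normal_on U x n"
    and "proper_on U x"
    and "0 \<in> singular_set U x"
    and "parallelly_smoothable_at U x n 0"
    and "rank (jacobian x (at 0)) = 1"
  shows "\<exists>(T :: real^3 \<Rightarrow> real^3) (\<delta>::real) (lam :: real^2 \<Rightarrow> real) (f1 :: real \<Rightarrow> real) (f2 :: real \<Rightarrow> real).
           (\<forall>a b. dist (T a) (T b) = dist a b) \<and>
           \<delta> > 0 \<and>
           smooth_on (open_square \<delta>) lam \<and>
           smooth_on {-\<delta><..<\<delta>} f1 \<and> smooth_on {-\<delta><..<\<delta>} f2 \<and>
           lam 0 = 0 \<and>
           (\<exists>N. open N \<and> 0 \<in> N \<and> no_sign_change_on N lam) \<and>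
           R_equivalent U (T \<circ> x) (open_square \<delta>) (normal_form lam f1 f2) 0"
proof -
  have sx: "smooth_on U x" and sn: "smooth_on U n"
    using assms(3,5) by (auto simp: wavefront_on_def unit_normal_on_def)
  have unit: "norm (n q) = 1" if "q \<in> U" for q using assms(5) that by (simp add: unit_normal_on_def)
  note perp = unit_normal_on_perp[OF assms(5) sx]
  let ?X = "\<lambda>q. frechet_derivative x (at q)" and ?N = "\<lambda>q. frechet_derivative n (at q)"
  have X: "(x has_derivative ?X q) (at q)" and N: "(n has_derivative ?N q) (at q)" if "q \<in> U" for q
    using smooth_on_has_derivative sx sn that by blast+
  obtain a where a: "norm a = 1" "range (?X 0) = range (\<lambda>c. c *\<^sub>R a)"
    using rank_one_image[OF has_derivative_linear[OF X[OF assms(2)]]] assms(9)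
    unfolding jacobian_def by blast
  obtain V \<epsilon> s where V: "open V" "0 \<in> V" "V \<subseteq> U" "0 < \<epsilon>" "s = 1 \<or> s = (-1::real)"
    and inj: "\<forall>q\<in>V. \<forall>l. 0 < l \<and> l < \<epsilon> \<longrightarrow> inj (\<lambda>v. ?X q v + l *\<^sub>R s *\<^sub>R ?N q v)"
    by (rule parallelly_smoothable_cases[OF sx sn assms(8)])
  have "a \<in> range (?X 0)" unfolding a(2) by (metis rangeI scaleR_one)
  then obtain j where j: "?X 0 j = a" by auto
  have "n 0 \<bullet> a = 0" using perp[OF assms(2), of j] j by simp
  then have "norm (s *\<^sub>R n 0) = 1" "(s *\<^sub>R n 0) \<bullet> a = 0" using unit[OF assms(2)] V(5) by auto
  then obtain T :: "real^3 \<Rightarrow> real^3"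
    where T: "orthogonal_transformation T" "T a = axis 1 1" "T (s *\<^sub>R n 0) = axis 3 1"
    by (rule adapted_isometry[OF a(1)])
  have linT: "linear T" and innerT: "T v \<bullet> T w = v \<bullet> w" for v w
    using T(1) by (auto simp: orthogonal_transformation_def)
  have blT: "bounded_linear T" using linT by (simp add: linear_conv_bounded_linear)
  have injT: "inj T" using orthogonal_transformation_inj[OF T(1)] .
  let ?x = "T \<circ> x" and ?n = "\<lambda>q. T (s *\<^sub>R n q)"
  have DX: "frechet_derivative ?x (at q) = (\<lambda>v. T (?X q v))" if "q \<in> U" for q
    using frechet_derivative_at[OF bounded_linear.has_derivative[OF blT X[OF that]]] by (simp add: o_def)
  have DN: "frechet_derivative ?n (at q) = (\<lambda>v. T (s *\<^sub>R ?N q v))" if "q \<in> U" for q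
    using frechet_derivative_at[OF bounded_linear.has_derivative[OF blT
        has_derivative_scaleR_right[OF N[OF that]]]] by simp
  have VU: "q \<in> U" if "q \<in> V" for q using V(3) that by auto
  have "\<exists>\<delta> lam f1 f2. \<delta> > 0 \<and> smooth_on (open_square \<delta>) lam \<and>
    smooth_on {-\<delta><..<\<delta>} f1 \<and> smooth_on {-\<delta><..<\<delta>} f2 \<and> lam 0 = 0 \<and>
    no_sign_change_on (open_square \<delta>) lam \<and>
    R_equivalent V ?x (open_square \<delta>) (normal_form lam f1 f2) 0"
  proof (rule normal_form_of_adapted_germ[where n = ?n and j = j and \<epsilon> = \<epsilon>, OF V(1,2)])
    show "smooth_on V ?x"
      unfolding o_def by (rule smooth_on_linear_image[OF blT V(1) smooth_on_subset[OF sx V(3)]])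
    show "smooth_on V ?n"
      by (rule smooth_on_linear_image[OF bounded_linear_compose[OF blT bounded_linear_scaleR_right] V(1)
            smooth_on_subset[OF sn V(3)]])
    show "?x 0 = 0" using assms(4) linT by (simp add: linear_0)
    show "?n 0 = axis 3 1" using T(3) .
    show "norm (?n q) = 1" if "q \<in> V" for q
      using orthogonal_transformation_norm[OF T(1)] unit[OF VU[OF that]] V(5) by auto
    show "?n q \<bullet> frechet_derivative ?x (at q) v = 0" if "q \<in> V" for q v
      using perp[OF VU[OF that]] by (simp add: DX[OF VU[OF that]] innerT)
    show "frechet_derivative ?x (at 0) v $ 2 = 0" for v
    proof -
      have "?X 0 v \<in> range (\<lambda>c. c *\<^sub>R a)" unfolding a(2)[symmetric] by (rule rangeI)
      then obtain c where "?X 0 v = c *\<^sub>R a" by auto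
      then show ?thesis using T(2) linT by (simp add: DX[OF assms(2)] linear_scale axis_def)
    qed
    show "frechet_derivative ?x (at 0) j \<noteq> 0"
      using T(2) j by (simp add: DX[OF assms(2)])
    show "u = 0" if "frechet_derivative ?x (at 0) u = 0" "frechet_derivative ?n (at 0) u = 0" for u
    proof (rule wavefront_immersive_with_normal[OF assms(3,6,5,2)])
      have 0: "v = 0" if "T v = 0" for v using injD[OF injT, of v 0] that linear_0[OF linT] by simp
      show "?X 0 u = 0" using that(1) 0 by (simp add: DX[OF assms(2)])
      show "?N 0 u = 0" using that(2) 0[of "s *\<^sub>R ?N 0 u"] V(5) by (auto simp: DN[OF assms(2)])
    qed
    show "0 < \<epsilon>" using V(4) .
    show "inj (\<lambda>v. frechet_derivative ?x (at q) v + l *\<^sub>R frechet_derivative ?n (at q) v)"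
      if "q \<in> V" "0 < l" "l < \<epsilon>" for q l
      using inj_compose[OF injT inj[rule_format, OF that(1) conjI[OF that(2,3)]]] linT
      unfolding DX[OF VU[OF that(1)]] DN[OF VU[OF that(1)]] by (simp add: o_def linear_add linear_scale)
  qed
  then obtain \<delta> lam f1 f2 where res: "\<delta> > 0" "smooth_on (open_square \<delta>) lam"
    "smooth_on {-\<delta><..<\<delta>} f1" "smooth_on {-\<delta><..<\<delta>} f2" "lam 0 = 0"
    "no_sign_change_on (open_square \<delta>) lam"
    "R_equivalent V ?x (open_square \<delta>) (normal_form lam f1 f2) 0"
    by blast
  moreover have "\<exists>N. open N \<and> 0 \<in> N \<and> no_sign_change_on N lam"
  proof (intro exI conjI)
    show "open (open_square \<delta>)" by (rule open_open_square)
    show "0 \<in> open_square \<delta>" using res(1) by (simp add: open_square_def)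
  qed (rule res(6))
  moreover have "R_equivalent U ?x (open_square \<delta>) (normal_form lam f1 f2) 0"
    using R_equivalent_subset[OF res(7) V(3)] .
  ultimately show ?thesis using T(1) unfolding orthogonal_transformation_isometry by blast
qed

end
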